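(* Let $\mathcal F$ be an equidistant foliation of $\mathbb R^{k+n}$ with affine leaf $F_0=\mathbb R^k\times\{0\}$, and assume that for every $p\in F_0$ the induced foliation $\tilde{\mathcal F}_p=\{F\cap L_p\mid F\in\mathcal F\}$ of the horizontal layer $L_p$ is homogeneous. Then for any $p,q\in F_0$ the induced foliations $\tilde{\mathcal F}_p$ and $\tilde{\mathcal F}_q$ are isometric to each other.
   Context: An equidistant foliation of $\mathbb R^m$ is a partition $\mathcal F$ of $\mathbb R^m$ into complete, smooth, connected, properly embedded submanifolds (leaves, possibly of different dimensions) such that for any two leaves $F,G\in\mathcal F$ and $p\in F$ the distance $\operatorname{dist}(p,G)$ does not depend on the choice of $p\in F$, and such that any vector tangent to a leaf can be locally extended to a smooth vector field everywhere tangent to the leaves. Every equidistant foliation of Euclidean space has a leaf that is an affine subspace; coordinates are chosen so that this leaf is $F_0=\mathbb R^k\times\{0\}$. For $p\in F_0$ the horizontal layer is $L_p=p+\nu_pF_0=p+(\{0\}\times\mathbb R^n)$, identified with $\mathbb R^n$ with origin $p$. $\tilde{\mathcal F}_p$ is homogeneous if its leaves are the orbits of some connected closed subgroup of $\operatorname{SO}(n)$ acting on $L_p\cong\mathbb R^n$ by the restriction of the standard representation. Two foliations $\tilde{\mathcal F}_p,\tilde{\mathcal F}_q$ are isometric if there is an isometry $L_p\to L_q$ mapping leaves of $\tilde{\mathcal F}_p$ onto leaves of $\tilde{\mathcal F}_q$. *)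

theory Defs
  imports "HOL-Analysis.Analysis"
begin

section \<open>Smooth maps and submanifolds of Euclidean space\<close>

primrec Ck_on :: "nat \<Rightarrow> ('a::euclidean_space \<Rightarrow> 'b::real_normed_vector) \<Rightarrow> 'a set \<Rightarrow> bool" where
  "Ck_on 0 f U \<longleftrightarrow> continuous_on U f"
| "Ck_on (Suc r) f U \<longleftrightarrow>
     (\<forall>x\<in>U. f differentiable (at x)) \<and> (\<forall>v. Ck_on r (\<lambda>x. frechet_derivative f (at x) v) U)"

text \<open>The derivatives are taken in the full space, so this is meant for open sets only.\<close>
definition smooth_on :: "'a::euclidean_space set \<Rightarrow> ('a \<Rightarrow> 'b::real_normed_vector) \<Rightarrow> bool" where
  "smooth_on U f \<longleftrightarrow> (\<forall>r. Ck_on r f U)"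

text \<open>Slice charts: near each of its points the set is straightened onto a linear subspace by a
  diffeomorphism between open subsets of the ambient space.\<close>
definition embedded_submanifold :: "nat \<Rightarrow> 'a::euclidean_space set \<Rightarrow> bool" where
  "embedded_submanifold d S \<longleftrightarrow>
     (\<forall>x\<in>S. \<exists>U V f g. \<exists>T :: 'a set. open U \<and> x \<in> U \<and> open V \<and> homeomorphism U V f g \<and>
        smooth_on U f \<and> smooth_on V g \<and> subspace T \<and> dim T = d \<and> f ` (S \<inter> U) = T \<inter> V)"

definition tangent_vectors :: "'a::euclidean_space set \<Rightarrow> 'a \<Rightarrow> 'a set" where
  "tangent_vectors S x =
     {v. \<exists>c e. 0 < e \<and> smooth_on {-e<..<e} c \<and> c ` {-e<..<e} \<subseteq> S \<and> c 0 = x \<and>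
          (c has_vector_derivative v) (at (0::real))}"

text \<open>The Riemannian distance of a submanifold with the metric induced from the ambient space:
  the infimum of the lengths of the piecewise continuously differentiable paths inside it. The
  library notion of a valid path does not bound the derivative near a breakpoint, so finiteness
  of the length has to be demanded; this is why \<^const>\<open>has_integral\<close> is used here rather
  than \<^const>\<open>integral\<close>.\<close>
definition riemannian_dist :: "'a::euclidean_space set \<Rightarrow> 'a \<Rightarrow> 'a \<Rightarrow> real" where
  "riemannian_dist S x y =
     Inf {l. \<exists>c. valid_path c \<and> path_image c \<subseteq> S \<and> pathstart c = x \<and> pathfinish c = y \<and>
               ((\<lambda>t. norm (vector_derivative c (at t))) has_integral l) {0..1}}"

text \<open>Properness is that of the inclusion map; completeness refers to the Riemannian distance of
  the submanifold and not to the distance of the ambient space.\<close>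
definition foliation_leaf :: "'a::euclidean_space set \<Rightarrow> bool" where
  "foliation_leaf S \<longleftrightarrow>
     (\<exists>d. embedded_submanifold d S) \<and> connected S \<and>
     proper_map (top_of_set S) euclidean (\<lambda>x. x) \<and>
     Metric_space.mcomplete S (riemannian_dist S)"


section \<open>Equidistant foliations\<close>

definition equidistant_foliation :: "'a::euclidean_space set set \<Rightarrow> bool" where
  "equidistant_foliation \<F> \<longleftrightarrow>
     partition_on UNIV \<F> \<and>
     (\<forall>F\<in>\<F>. foliation_leaf F) \<and>
     (\<forall>F\<in>\<F>. \<forall>G\<in>\<F>. \<forall>p\<in>F. \<forall>q\<in>F. infdist p G = infdist q G) \<and>
     (\<forall>F\<in>\<F>. \<forall>x\<in>F. \<forall>v \<in> tangent_vectors F x.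
        \<exists>U X. open U \<and> x \<in> U \<and> smooth_on U X \<and> X x = v \<and>
          (\<forall>G\<in>\<F>. \<forall>y \<in> G \<inter> U. X y \<in> tangent_vectors G y))"

text \<open>The splitting of Euclidean space into the two factors of dimensions k and n is encoded by
  the set \<open>K\<close> of the indices of the first factor, so k is the cardinality of \<open>K\<close> and n that of
  its complement. Either of them may be zero.\<close>
definition first_factor :: "'m set \<Rightarrow> (real^'m) set" where
  "first_factor K = {x. \<forall>i. i \<notin> K \<longrightarrow> x $ i = 0}"

definition second_factor :: "'m set \<Rightarrow> (real^'m) set" where
  "second_factor K = {x. \<forall>i\<in>K. x $ i = 0}"

definition horizontal_layer :: "'m set \<Rightarrow> real^'m \<Rightarrow> (real^'m) set" where
  "horizontal_layer K p = {p + v |v. v \<in> second_factor K}"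

definition induced_foliation :: "'a set set \<Rightarrow> 'a set \<Rightarrow> 'a set set" where
  "induced_foliation \<F> L = {F \<inter> L |F. F \<in> \<F>}"

text \<open>The special orthogonal group of the second factor, as block matrices that are the identity
  on the first factor.\<close>
definition SO_second :: "'m::finite set \<Rightarrow> (real^'m^'m) set" where
  "SO_second K =
     {A. rotation_matrix A \<and> (\<forall>i j. i \<in> K \<or> j \<in> K \<longrightarrow> A $ i $ j = (if i = j then 1 else 0))}"

definition connected_closed_subgroup_SO :: "'m::finite set \<Rightarrow> (real^'m^'m) set \<Rightarrow> bool" where
  "connected_closed_subgroup_SO K H \<longleftrightarrow>
     H \<subseteq> SO_second K \<and> mat 1 \<in> H \<and> (\<forall>A\<in>H. \<forall>B\<in>H. A ** B \<in> H) \<and> (\<forall>A\<in>H. matrix_inv A \<in> H) \<and>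
     connected H \<and> closed H"

definition homogeneous_on_layer :: "'m::finite set \<Rightarrow> real^'m \<Rightarrow> (real^'m) set set \<Rightarrow> bool" where
  "homogeneous_on_layer K p \<G> \<longleftrightarrow>
     (\<exists>H. connected_closed_subgroup_SO K H \<and>
        \<G> = {{p + A *v (x - p) |A. A \<in> H} |x. x \<in> horizontal_layer K p})"

definition isometric_foliations ::
    "'a::metric_space set \<Rightarrow> 'a set set \<Rightarrow> 'b::metric_space set \<Rightarrow> 'b set set \<Rightarrow> bool" where
  "isometric_foliations L \<G> L' \<G>' \<longleftrightarrow>
     (\<exists>f. f ` L = L' \<and> (\<forall>x\<in>L. \<forall>y\<in>L. dist (f x) (f y) = dist x y) \<and> (\<lambda>S. f ` S) ` \<G> = \<G>')"

end

theory Submission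
  imports Defs
begin

text \<open>
  Write \<open>E\<close> for the affine leaf and \<open>N\<close> for its orthogonal complement, and let \<open>q + v\<close> with
  \<open>q\<close> in \<open>E\<close>, \<open>v\<close> in \<open>N\<close> be a point of the layer at \<open>q\<close>. Homogeneity lets every leaf meet
  every layer in exactly one orbit, so the orbit spaces of all layers are in bijection with the
  space of leaves. The proof compares the metrics that this one space inherits from two layers and
  the groups that act on them.

  \<^emph>\<open>All layers induce the same metric on the space of leaves.\<close> The distance to \<open>E\<close> is constant on
  leaves, and equality in the triangle inequality shows that the homotheties
  \<open>a + v \<mapsto> a + t v\<close> permute the leaves (\<open>homothety\<close>). If two leaves are shrunk by a small
  factor \<open>t\<close>, the point of the second nearest to a given point of the first lies almost in
  the same layer; dividing by \<open>t\<close> and letting \<open>t\<close> tend to \<open>0\<close> expresses the distance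
  of their slices in one layer through distances between leaves, which do not see the layer
  (\<open>layer_distance_transfer\<close>).

  \<^emph>\<open>The groups vary semicontinuously.\<close> Let \<open>G\<^sub>q\<close> be the compact group of all orthogonal maps that fix
  \<open>E\<close> pointwise and preserve each leaf's slice of the layer at \<open>q\<close>. For \<open>q\<close> close to \<open>p\<close>, equidistance
  forces \<open>G\<^sub>q\<close> into a small neighbourhood of \<open>G\<^sub>p\<close> (\<open>layer_group_upper_semicontinuous\<close>). By a
  theorem of Montgomery and Zippin (\<open>near_subgroup_conjugate\<close>), \<open>G\<^sub>q\<close> is then conjugate by some
  orthogonal \<open>B\<close> to a subgroup of \<open>G\<^sub>p\<close>.

  \<^emph>\<open>Subconjugacy is already congruence.\<close> The conjugation maps the orbits of \<open>G\<^sub>q\<close> into those of \<open>G\<^sub>p\<close>, so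
  it induces a surjective distance nonincreasing self-map of the space of leaves. It preserves the
  distance to \<open>E\<close>, hence compact balls, and a surjective nonexpanding self-map of a compact metric
  space is injective (\<open>recurrent_pair\<close>). Thus \<open>B\<close> carries the foliation of the layer at \<open>p\<close> onto
  that at \<open>q\<close> (\<open>subconjugate_imp_congruent\<close>). Congruence of layers is an equivalence relation with
  open classes on the connected set \<open>E\<close>, so all layers are congruent.

  The theorem of Montgomery and Zippin is proved for closed groups \<open>G \<subseteq> \<Gamma>\<close> of orthogonal matrices by a
  fixed point argument: a subgroup \<open>H\<close> close to \<open>G\<close> moves the base point of \<open>\<Gamma> / G\<close> only a little, the
  circumcentre of its orbit is unique since small balls are uniformly convex
  (\<open>coset_midpoint\<close>), so it is a fixed coset \<open>B G\<close>, which means \<open>B\<inverse> H B \<subseteq> G\<close>. The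
  convexity only requires that each group be approximated by its tangent space to second order;
  this is obtained from powers of matrices near the identity (\<open>secant_limit\<close>,
  \<open>group_tangents_quadratic\<close>), without exponentials or Haar measure.
\<close>

section \<open>The Frobenius norm of matrices\<close>

lemma matrix_mul_diff_right: "(A::real^'n^'n) ** (B - C) = A ** B - A ** C"
  by (simp add: matrix_matrix_mult_def vec_eq_iff right_diff_distrib sum_subtractf)

lemma matrix_mul_diff_left: "((B::real^'n^'n) - C) ** A = B ** A - C ** A"
  by (simp add: matrix_matrix_mult_def vec_eq_iff left_diff_distrib sum_subtractf)

lemma matrix_mul_scaleR_right: "(A::real^'n^'n) ** (c *\<^sub>R B) = c *\<^sub>R (A ** B)"
  by (simp add: matrix_matrix_mult_def vec_eq_iff sum_distrib_left mult.left_commute)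

lemma transpose_diff: "transpose ((A::real^'n^'n) - B) = transpose A - transpose B"
  by (simp add: transpose_def vec_eq_iff)

lemma inner_matrix_trace: "(A::real^'n^'n) \<bullet> B = trace (transpose A ** B)"
  unfolding inner_vec_def trace_def matrix_matrix_mult_def transpose_def
  by (simp, subst sum.swap, rule refl)

lemma inner_matrix_mul_left: "((Q::real^'n^'n) ** (A::real^'n^'n)) \<bullet> B = A \<bullet> (transpose Q ** B)"
  by (simp add: inner_matrix_trace matrix_transpose_mul matrix_mul_assoc)

lemma inner_transpose: "transpose (A::real^'n^'n) \<bullet> transpose B = A \<bullet> B"
  by (metis inner_matrix_trace inner_commute matrix_transpose_mul trace_mul_sym transpose_transpose)

lemma norm_transpose [simp]: "norm (transpose (A::real^'n^'n)) = norm A"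
  by (simp add: norm_eq_sqrt_inner inner_transpose)

lemma norm_orthogonal_mul_left:
  assumes "orthogonal_matrix (Q::real^'n^'n)" shows "norm (Q ** (A::real^'n^'n)) = norm A"
  using assms
  by (simp add: norm_eq_sqrt_inner inner_matrix_mul_left matrix_mul_assoc orthogonal_matrix_def)

lemma norm_orthogonal_mul_right:
  assumes "orthogonal_matrix (Q::real^'n^'n)" shows "norm ((A::real^'n^'n) ** Q) = norm A"
  by (metis assms matrix_transpose_mul norm_orthogonal_mul_left norm_transpose orthogonal_matrix_transpose)

lemma norm_matrix_mul: "norm ((A::real^'n^'n) ** (B::real^'n^'n)) \<le> norm A * norm B"
proof -
  have sq: "(norm M)\<^sup>2 = (\<Sum>i\<in>UNIV. (norm (M $ i))\<^sup>2)" for M :: "real^'n^'n"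
    by (simp add: norm_vec_def L2_set_def real_sqrt_pow2 sum_nonneg)
  have sq': "(norm v)\<^sup>2 = (\<Sum>i\<in>UNIV. (v $ i)\<^sup>2)" for v :: "real^'n"
    by (simp add: norm_vec_def L2_set_def real_sqrt_pow2 sum_nonneg)
  have entry: "(A ** B) $ i $ j = A $ i \<bullet> transpose B $ j" for i j
    by (simp add: matrix_matrix_mult_def inner_vec_def transpose_def)
  have "(norm (A ** B))\<^sup>2 = (\<Sum>i\<in>UNIV. \<Sum>j\<in>UNIV. (A $ i \<bullet> transpose B $ j)\<^sup>2)"
    unfolding sq sq' entry ..
  also have "\<dots> \<le> (\<Sum>i\<in>UNIV. \<Sum>j\<in>UNIV. (norm (A $ i))\<^sup>2 * (norm (transpose B $ j))\<^sup>2)"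
    by (intro sum_mono) (metis Cauchy_Schwarz_ineq dot_square_norm)
  also have "\<dots> = (norm A)\<^sup>2 * (norm (transpose B))\<^sup>2"
    unfolding sq by (simp add: sum_product)
  finally show ?thesis
    by (simp add: power_mult_distrib[symmetric])
qed

lemma norm_orthogonal_matrix:
  assumes "orthogonal_matrix (Q::real^'n^'n)" shows "norm Q = norm (mat 1 :: real^'n^'n)"
  by (metis assms matrix_mul_rid norm_orthogonal_mul_left)

lemma continuous_on_matrix_mul [continuous_intros]:
  fixes f g :: "'a::topological_space \<Rightarrow> real^'n^'n"
  assumes "continuous_on S f" "continuous_on S g"
  shows "continuous_on S (\<lambda>x. f x ** g x)"
  unfolding matrix_matrix_mult_def by (intro continuous_intros assms)

lemma orthogonal_matrix_cancel:
  assumes "orthogonal_matrix (Q::real^'n^'n)"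
  shows "transpose Q *v (Q *v x) = x" "Q *v (transpose Q *v x) = x" "norm (Q *v x) = norm x"
    "norm (Q *v x - Q *v y) = norm (x - y)"
proof -
  have QQ: "transpose Q ** Q = mat 1" "Q ** transpose Q = mat 1"
    using assms by (auto simp: orthogonal_matrix_def)
  show "transpose Q *v (Q *v x) = x" "Q *v (transpose Q *v x) = x"
    unfolding matrix_vector_mul_assoc QQ by (rule matrix_vector_mul_lid)+
  have *: "norm (Q *v z) = norm z" for z
  proof -
    have "(Q *v z) \<bullet> (Q *v z) = (z v* transpose Q) \<bullet> (Q *v z)" by simp
    also have "\<dots> = z \<bullet> z"
      unfolding dot_lmul_matrix matrix_vector_mul_assoc QQ matrix_vector_mul_lid ..
    finally show ?thesis by (simp add: norm_eq_sqrt_inner)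
  qed
  show "norm (Q *v x) = norm x" by (rule *)
  show "norm (Q *v x - Q *v y) = norm (x - y)"
    using *[of "x - y"] by (simp add: matrix_vector_mult_diff_distrib)
qed

lemma continuous_on_matrix_vector [continuous_intros]:
  fixes f :: "'a::topological_space \<Rightarrow> real^'n^'m"
  assumes "continuous_on S f" "continuous_on S g" shows "continuous_on S (\<lambda>x. f x *v g x)"
  unfolding matrix_vector_mult_def by (intro continuous_intros assms)

lemma continuous_on_transpose [continuous_intros]:
  fixes f :: "'a::topological_space \<Rightarrow> real^'n^'m"
  assumes "continuous_on S f" shows "continuous_on S (\<lambda>x. transpose (f x))"
  unfolding transpose_def by (intro continuous_intros assms)

lemma tendsto_matrix_vector [tendsto_intros]:
  fixes f :: "'a \<Rightarrow> real^'n^'m"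
  assumes "(f \<longlongrightarrow> A) F" "(g \<longlongrightarrow> x) F" shows "((\<lambda>x. f x *v g x) \<longlongrightarrow> A *v x) F"
  unfolding matrix_vector_mult_def by (rule vec_tendstoI, simp only: vec_lambda_beta)
    (intro tendsto_sum tendsto_mult tendsto_vec_nth assms)

section \<open>Closed groups of orthogonal matrices and their tangent spaces\<close>

lemma compact_subsequence:
  fixes f :: "nat \<Rightarrow> 'a::metric_space"
  assumes "compact S" "\<And>n. f n \<in> S"
  obtains l r where "l \<in> S" "strict_mono r" "(\<lambda>n. f (r n)) \<longlonglongrightarrow> l"
  using seq_compactE[of S f] assms by (auto simp: compact_eq_seq_compact_metric o_def)

text \<open>Inverses are expressed by transposes, which agree with them on orthogonal matrices.\<close>
definition closed_orthogonal_group :: "(real^'n^'n) set \<Rightarrow> bool" where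
  "closed_orthogonal_group G \<longleftrightarrow> (\<forall>A\<in>G. orthogonal_matrix A) \<and> mat 1 \<in> G \<and>
     (\<forall>A\<in>G. \<forall>B\<in>G. A ** B \<in> G) \<and> (\<forall>A\<in>G. transpose A \<in> G) \<and> closed G"

lemma closed_orthogonal_groupD:
  assumes "closed_orthogonal_group G"
  shows "A \<in> G \<Longrightarrow> orthogonal_matrix A" "mat 1 \<in> G"
    "A \<in> G \<Longrightarrow> B \<in> G \<Longrightarrow> A ** B \<in> G" "A \<in> G \<Longrightarrow> transpose A \<in> G" "closed G"
  using assms unfolding closed_orthogonal_group_def by blast+

lemma closed_orthogonal_group_compact:
  assumes "closed_orthogonal_group (G::(real^'n^'n) set)" shows "compact G"
proof -
  have "bounded G"
    unfolding bounded_iff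
    using closed_orthogonal_groupD(1)[OF assms] norm_orthogonal_matrix by (metis order_refl)
  then show ?thesis
    using closed_orthogonal_groupD(5)[OF assms] compact_eq_bounded_closed by blast
qed

fun matrix_pow :: "real^'n^'n \<Rightarrow> nat \<Rightarrow> real^'n^'n" where
  "matrix_pow A 0 = mat 1"
| "matrix_pow A (Suc k) = A ** matrix_pow A k"

lemma matrix_pow_in_group:
  "closed_orthogonal_group G \<Longrightarrow> A \<in> G \<Longrightarrow> matrix_pow A k \<in> G"
  by (induction k) (auto simp: closed_orthogonal_groupD)

lemma norm_matrix_pow_minus_one:
  assumes "orthogonal_matrix (A::real^'n^'n)"
  shows "norm (matrix_pow A k - mat 1) \<le> real k * norm (A - mat 1)"
proof (induction k)
  case (Suc k)
  have "matrix_pow A (Suc k) - mat 1 = A ** (matrix_pow A k - mat 1) + (A - mat 1)"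
    by (simp add: matrix_mul_diff_right)
  then have "norm (matrix_pow A (Suc k) - mat 1) \<le> norm (matrix_pow A k - mat 1) + norm (A - mat 1)"
    by (metis assms norm_orthogonal_mul_left norm_triangle_ineq)
  with Suc show ?case by (simp add: algebra_simps)
qed simp

text \<open>The induction adds an error of \<open>norm (A - mat 1) * norm (matrix_pow A k - mat 1)\<close> per
  factor. The bound is uniform in \<open>k\<close> as long as \<open>k * norm (A - mat 1)\<close> is bounded, so it survives
  when \<open>A\<close> tends to the identity while \<open>k\<close> tends to infinity.\<close>
lemma norm_matrix_pow_linearization:
  assumes "orthogonal_matrix (A::real^'n^'n)"
  shows "norm (matrix_pow A k - mat 1 - real k *\<^sub>R (A - mat 1)) \<le> (real k * norm (A - mat 1))\<^sup>2"
proof (induction k)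
  case (Suc k)
  let ?a = "norm (A - mat 1)"
  have "matrix_pow A (Suc k) - mat 1 - real (Suc k) *\<^sub>R (A - mat 1) =
     (matrix_pow A k - mat 1 - real k *\<^sub>R (A - mat 1)) + (A - mat 1) ** (matrix_pow A k - mat 1)"
    by (simp add: matrix_mul_diff_right matrix_mul_diff_left algebra_simps)
  then have "norm (matrix_pow A (Suc k) - mat 1 - real (Suc k) *\<^sub>R (A - mat 1)) \<le>
     (real k * ?a)\<^sup>2 + ?a * (real k * ?a)"
    using Suc norm_matrix_pow_minus_one[OF assms, of k]
      norm_matrix_mul[of "A - mat 1" "matrix_pow A k - mat 1"]
    by (smt (verit, best) mult_left_mono norm_ge_zero norm_triangle_ineq)
  also have "\<dots> \<le> (real (Suc k) * ?a)\<^sup>2"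
    by (simp add: power2_eq_square algebra_simps)
  finally show ?case .
qed simp

text \<open>The Lie algebra of the group, described without the exponential map: along a tangent
  direction the group is approximated to second order. The constant may depend on
  \<open>X\<close>, which makes closure under addition immediate; a uniform constant follows
  in \<open>group_tangents_exp\<close>.\<close>
definition group_tangents :: "(real^'n^'n) set \<Rightarrow> (real^'n^'n) set" where
  "group_tangents G = {X. \<exists>C. \<forall>s. 0 < s \<and> s \<le> 1 \<longrightarrow>
     (\<exists>A\<in>G. norm (A - mat 1 - s *\<^sub>R X) \<le> C * s\<^sup>2)}"

lemma group_tangents_add:
  assumes G: "closed_orthogonal_group (G::(real^'n^'n) set)"
    and "X \<in> group_tangents G" "Y \<in> group_tangents G"
  shows "X + Y \<in> group_tangents G"
proof -
  obtain C D where
    C: "\<And>s. 0 < s \<Longrightarrow> s \<le> 1 \<Longrightarrow> \<exists>A\<in>G. norm (A - mat 1 - s *\<^sub>R X) \<le> C * s\<^sup>2" and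
    D: "\<And>s. 0 < s \<Longrightarrow> s \<le> 1 \<Longrightarrow> \<exists>A\<in>G. norm (A - mat 1 - s *\<^sub>R Y) \<le> D * s\<^sup>2"
    using assms(2,3) unfolding group_tangents_def by blast
  let ?E = "C + D + (C + norm X) * (D + norm Y)"
  have "\<exists>A\<in>G. norm (A - mat 1 - s *\<^sub>R (X + Y)) \<le> ?E * s\<^sup>2" if s: "0 < s" "s \<le> 1" for s
  proof -
    obtain A where A: "A \<in> G" "norm (A - mat 1 - s *\<^sub>R X) \<le> C * s\<^sup>2" using C s by blast
    obtain B where B: "B \<in> G" "norm (B - mat 1 - s *\<^sub>R Y) \<le> D * s\<^sup>2" using D s by blast
    have s2: "0 < s\<^sup>2" "s\<^sup>2 \<le> s" using s by (auto simp: power2_eq_square mult_left_le)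
    have C0: "0 \<le> C" using A(2) s2(1) by (smt (verit) norm_ge_zero mult_neg_pos)
    have D0: "0 \<le> D" using B(2) s2(1) by (smt (verit) norm_ge_zero mult_neg_pos)
    have "norm (A - mat 1) \<le> C * s\<^sup>2 + norm (s *\<^sub>R X)"
      using A(2) by (metis add.commute add_le_cancel_right diff_add_cancel norm_triangle_mono order_refl)
    also have "\<dots> \<le> C * s + s * norm X"
      using s2 C0 s by (simp add: mult_left_mono)
    finally have a: "norm (A - mat 1) \<le> (C + norm X) * s" by (simp add: algebra_simps)
    have "norm (B - mat 1) \<le> D * s\<^sup>2 + norm (s *\<^sub>R Y)"
      using B(2) by (metis add.commute add_le_cancel_right diff_add_cancel norm_triangle_mono order_refl)
    also have "\<dots> \<le> D * s + s * norm Y"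
      using s2 D0 s by (simp add: mult_left_mono)
    finally have b: "norm (B - mat 1) \<le> (D + norm Y) * s" by (simp add: algebra_simps)
    have "A ** B - mat 1 - s *\<^sub>R (X + Y) =
        (A - mat 1 - s *\<^sub>R X) + (B - mat 1 - s *\<^sub>R Y) + (A - mat 1) ** (B - mat 1)"
      by (simp add: matrix_mul_diff_left matrix_mul_diff_right algebra_simps)
    moreover have "norm ((A - mat 1) ** (B - mat 1)) \<le> ((C + norm X) * s) * ((D + norm Y) * s)"
      using a b norm_matrix_mul[of "A - mat 1" "B - mat 1"]
      by (smt (verit) mult_mono norm_ge_zero)
    ultimately have "norm (A ** B - mat 1 - s *\<^sub>R (X + Y)) \<le>
        C * s\<^sup>2 + D * s\<^sup>2 + ((C + norm X) * s) * ((D + norm Y) * s)"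
      using A(2) B(2) by (metis norm_triangle_mono)
    also have "\<dots> = ?E * s\<^sup>2" by (simp add: power2_eq_square algebra_simps)
    finally show ?thesis using A(1) B(1) closed_orthogonal_groupD(3)[OF G] by blast
  qed
  then show ?thesis unfolding group_tangents_def by blast
qed

lemma group_tangents_uminus:
  assumes G: "closed_orthogonal_group (G::(real^'n^'n) set)"
    and "X \<in> group_tangents G"
  shows "- X \<in> group_tangents G"
proof -
  obtain C where
    C: "\<And>s. 0 < s \<Longrightarrow> s \<le> 1 \<Longrightarrow> \<exists>A\<in>G. norm (A - mat 1 - s *\<^sub>R X) \<le> C * s\<^sup>2"
    using assms(2) unfolding group_tangents_def by blast
  have "\<exists>A\<in>G. norm (A - mat 1 - s *\<^sub>R (- X)) \<le> (C + (C + norm X)\<^sup>2) * s\<^sup>2"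
    if s: "0 < s" "s \<le> 1" for s
  proof -
    obtain A where A: "A \<in> G" "norm (A - mat 1 - s *\<^sub>R X) \<le> C * s\<^sup>2" using C s by blast
    have s2: "0 < s\<^sup>2" "s\<^sup>2 \<le> s" using s by (auto simp: power2_eq_square mult_left_le)
    have C0: "0 \<le> C" using A(2) s2(1) by (smt (verit) norm_ge_zero mult_neg_pos)
    have "norm (A - mat 1) \<le> C * s\<^sup>2 + norm (s *\<^sub>R X)"
      using A(2) by (metis add.commute add_le_cancel_right diff_add_cancel norm_triangle_mono order_refl)
    also have "\<dots> \<le> C * s + s * norm X"
      using s2 C0 s by (simp add: mult_left_mono)
    finally have a: "norm (A - mat 1) \<le> (C + norm X) * s" by (simp add: algebra_simps)
    have oA: "transpose A ** A = mat 1"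
      using closed_orthogonal_groupD(1)[OF G A(1)] by (simp add: orthogonal_matrix_def)
    have "transpose A - mat 1 - s *\<^sub>R (- X) =
        - (A - mat 1 - s *\<^sub>R X) - transpose (A - mat 1) ** (A - mat 1)"
      by (simp add: matrix_mul_diff_left matrix_mul_diff_right transpose_diff transpose_mat oA algebra_simps)
    moreover have "norm (transpose (A - mat 1) ** (A - mat 1)) \<le> ((C + norm X) * s) * ((C + norm X) * s)"
      using a norm_matrix_mul[of "transpose (A - mat 1)" "A - mat 1"]
      by (smt (verit) mult_mono norm_ge_zero norm_transpose)
    ultimately have "norm (transpose A - mat 1 - s *\<^sub>R (- X)) \<le>
        C * s\<^sup>2 + ((C + norm X) * s) * ((C + norm X) * s)"
      using A(2) by (smt (verit) norm_minus_cancel norm_triangle_ineq4)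
    also have "\<dots> = (C + (C + norm X)\<^sup>2) * s\<^sup>2" by (simp add: power2_eq_square algebra_simps)
    finally show ?thesis using A(1) closed_orthogonal_groupD(4)[OF G] by blast
  qed
  then show ?thesis unfolding group_tangents_def by blast
qed

text \<open>A limit of secant directions at the identity is tangent, with constant \<open>1\<close>: the power of \<open>A n\<close>
  with exponent about \<open>s / norm (A n - mat 1)\<close> lies in the group and is within about \<open>s\<^sup>2\<close>
  of \<open>mat 1 + s *\<^sub>R X\<close>; compactness of the group gives a limit of these powers.\<close>
lemma secant_limit:
  assumes G: "closed_orthogonal_group (G::(real^'n^'n) set)"
    and A: "\<And>n. A n \<in> G" "\<And>n. A n \<noteq> mat 1" "A \<longlonglongrightarrow> mat 1"
    and X: "(\<lambda>n. (A n - mat 1) /\<^sub>R norm (A n - mat 1)) \<longlonglongrightarrow> X"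
    and s: "0 < s"
  shows "\<exists>B\<in>G. norm (B - mat 1 - s *\<^sub>R X) \<le> s\<^sup>2"
proof -
  define t where "t n = norm (A n - mat 1)" for n
  have t0: "0 < t n" for n using A(2)[of n] by (simp add: t_def)
  have tlim: "t \<longlonglongrightarrow> 0"
    unfolding t_def using A(3) by (simp add: LIM_zero_iff tendsto_norm_zero_iff)
  \<comment> \<open>The power of \<open>A n\<close> that moves a distance of about \<open>s\<close> away from the identity.\<close>
  define k where "k n = nat \<lfloor>s / t n\<rfloor>" for n
  have k: "real (k n) \<le> s / t n" "s / t n < real (k n) + 1" for n
  proof -
    have "0 \<le> s / t n" using t0[of n] s by simp
    then have "real (k n) = of_int \<lfloor>s / t n\<rfloor>" unfolding k_def by simp
    then show "real (k n) \<le> s / t n" "s / t n < real (k n) + 1" by linarith+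
  qed
  have "\<bar>real (k n) * t n - s\<bar> \<le> t n" for n
    using k[of n] t0[of n] by (simp add: field_simps abs_le_iff)
  then have "(\<lambda>n. real (k n) * t n - s) \<longlonglongrightarrow> 0"
    by (intro Lim_null_comparison[OF _ tlim]) auto
  then have klim: "(\<lambda>n. real (k n) * t n) \<longlonglongrightarrow> s" by (simp add: LIM_zero_iff)
  have mem: "matrix_pow (A n) (k n) \<in> G" for n by (rule matrix_pow_in_group[OF G A(1)])
  obtain B r where B: "B \<in> G" "strict_mono r" "(\<lambda>n. matrix_pow (A (r n)) (k (r n))) \<longlonglongrightarrow> B"
    by (rule compact_subsequence[OF closed_orthogonal_group_compact[OF G] mem])
  have sub: "(\<lambda>n. f (r n)) \<longlonglongrightarrow> l" if "f \<longlonglongrightarrow> l" for f :: "nat \<Rightarrow> 'z::topological_space" and l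
    by (rule LIMSEQ_subseq_LIMSEQ[OF that B(2), unfolded o_def])
  let ?f = "\<lambda>n. matrix_pow (A (r n)) (k (r n)) - mat 1 - 
     (real (k (r n)) * t (r n)) *\<^sub>R ((A (r n) - mat 1) /\<^sub>R norm (A (r n) - mat 1))"
  have "norm (?f n) \<le> (real (k (r n)) * t (r n))\<^sup>2" for n
    using norm_matrix_pow_linearization[OF closed_orthogonal_groupD(1)[OF G A(1)[of "r n"]], where k="k (r n)"]
      t0[of "r n"] by (simp add: t_def mult.assoc)
  moreover have "(\<lambda>n. norm (?f n)) \<longlonglongrightarrow> norm (B - mat 1 - s *\<^sub>R X)"
    by (intro tendsto_intros B(3) sub[OF X] sub[OF klim])
  moreover have "(\<lambda>n. (real (k (r n)) * t (r n))\<^sup>2) \<longlonglongrightarrow> s\<^sup>2"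
    by (intro tendsto_intros sub[OF klim])
  ultimately have "norm (B - mat 1 - s *\<^sub>R X) \<le> s\<^sup>2"
    by (intro LIMSEQ_le) auto
  then show ?thesis using B(1) by blast
qed

text \<open>The matrix found here plays the role of the exponential of \<open>X\<close>. The error is uniform because
  a tangent vector, once normalized, is itself a secant limit, and \<open>secant_limit\<close> has constant
  \<open>1\<close>.\<close>
lemma group_tangents_exp:
  assumes G: "closed_orthogonal_group (G::(real^'n^'n) set)"
    and X: "X \<in> group_tangents G"
  shows "\<exists>A\<in>G. norm (A - mat 1 - X) \<le> (norm X)\<^sup>2"
proof (cases "X = 0")
  case True
  then show ?thesis using closed_orthogonal_groupD(2)[OF G] by force
next
  case False
  obtain C where
    C: "\<And>s. 0 < s \<Longrightarrow> s \<le> 1 \<Longrightarrow> \<exists>A\<in>G. norm (A - mat 1 - s *\<^sub>R X) \<le> C * s\<^sup>2"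
    using X unfolding group_tangents_def by blast
  have "\<exists>A\<in>G. norm (A - mat 1 - inverse (real (Suc n)) *\<^sub>R X) \<le> C * (inverse (real (Suc n)))\<^sup>2" for n
    by (rule C) (auto simp: field_simps)
  then obtain A where A: "\<And>n. A n \<in> G"
    "\<And>n. norm (A n - mat 1 - inverse (real (Suc n)) *\<^sub>R X) \<le> C * (inverse (real (Suc n)))\<^sup>2"
    by metis
  define Q where "Q n = real (Suc n) *\<^sub>R (A n - mat 1)" for n
  have "norm (Q n - X) \<le> C * inverse (real (Suc n))" for n
  proof -
    have "Q n - X = real (Suc n) *\<^sub>R (A n - mat 1 - inverse (real (Suc n)) *\<^sub>R X)"
      by (simp add: Q_def scaleR_diff_right)
    then have "norm (Q n - X) = real (Suc n) * norm (A n - mat 1 - inverse (real (Suc n)) *\<^sub>R X)"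
      by simp
    also have "\<dots> \<le> real (Suc n) * (C * (inverse (real (Suc n)))\<^sup>2)"
      by (intro mult_left_mono A(2)) auto
    also have "\<dots> = C * inverse (real (Suc n))"
      by (simp add: power2_eq_square)
    finally show ?thesis .
  qed
  moreover have "(\<lambda>n. C * inverse (real (Suc n))) \<longlonglongrightarrow> 0"
    using tendsto_mult_right_zero[OF LIMSEQ_inverse_real_of_nat] .
  ultimately have "(\<lambda>n. Q n - X) \<longlonglongrightarrow> 0"
    by (rule Lim_null_comparison[OF eventuallyI])
  then have Q: "Q \<longlonglongrightarrow> X" by (simp add: LIM_zero_iff)
  have "\<forall>\<^sub>F n in sequentially. Q n \<noteq> 0"
    using tendsto_imp_eventually_ne[OF Q] False by blast
  then obtain N where N: "\<And>n. n \<ge> N \<Longrightarrow> Q n \<noteq> 0" by (auto simp: eventually_sequentially)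
  \<comment> \<open>Dropping finitely many terms keeps the sequence away from the identity, so that it has secants.\<close>
  define A' where "A' n = A (n + N)" for n
  have A'Q: "A' n - mat 1 = inverse (real (Suc (n + N))) *\<^sub>R Q (n + N)" for n
    by (simp add: A'_def Q_def)
  have Q': "(\<lambda>n. Q (n + N)) \<longlonglongrightarrow> X" using Q by (rule LIMSEQ_ignore_initial_segment)
  have "(\<lambda>n. A' n - mat 1) \<longlonglongrightarrow> 0 *\<^sub>R X"
    unfolding A'Q by (intro tendsto_scaleR Q' LIMSEQ_ignore_initial_segment[OF LIMSEQ_inverse_real_of_nat])
  then have lim: "A' \<longlonglongrightarrow> mat 1" by (simp add: LIM_zero_iff)
  have ne: "A' n \<noteq> mat 1" for n
    using A'Q[of n] N[of "n + N"] by auto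
  have "(A' n - mat 1) /\<^sub>R norm (A' n - mat 1) = Q (n + N) /\<^sub>R norm (Q (n + N))" for n
    unfolding A'Q by (simp add: field_simps)
  moreover have "(\<lambda>n. Q (n + N) /\<^sub>R norm (Q (n + N))) \<longlonglongrightarrow> X /\<^sub>R norm X"
    using False by (intro tendsto_intros Q') auto
  ultimately have "(\<lambda>n. (A' n - mat 1) /\<^sub>R norm (A' n - mat 1)) \<longlonglongrightarrow> X /\<^sub>R norm X" by simp
  from secant_limit[OF G _ ne lim this, of "norm X"] A(1) False
  show ?thesis by (simp add: A'_def)
qed

lemma subspace_group_tangents:
  assumes G: "closed_orthogonal_group (G::(real^'n^'n) set)"
  shows "subspace (group_tangents G)"
proof -
  have zero: "0 \<in> group_tangents G"
    using closed_orthogonal_groupD(2)[OF G] unfolding group_tangents_def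
    by (auto intro!: exI[of _ 0] bexI[of _ "mat 1"])
  have small: "c *\<^sub>R X \<in> group_tangents G" if X: "X \<in> group_tangents G" and c: "0 < c" "c \<le> 1" for c X
  proof -
    obtain C where
      C: "\<And>s. 0 < s \<Longrightarrow> s \<le> 1 \<Longrightarrow> \<exists>A\<in>G. norm (A - mat 1 - s *\<^sub>R X) \<le> C * s\<^sup>2"
      using X unfolding group_tangents_def by blast
    have "\<exists>A\<in>G. norm (A - mat 1 - s *\<^sub>R c *\<^sub>R X) \<le> (C * c\<^sup>2) * s\<^sup>2" if "0 < s" "s \<le> 1" for s
      using C[of "s * c"] that c by (simp add: mult_le_one power_mult_distrib mult_ac)
    then show ?thesis unfolding group_tangents_def by blast
  qed
  have nat: "real k *\<^sub>R X \<in> group_tangents G" if "X \<in> group_tangents G" for k X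
    by (induction k) (auto simp: zero scaleR_left_distrib intro!: group_tangents_add[OF G] that)
  \<comment> \<open>A factor above \<open>1\<close> is an integer multiple followed by a factor in the unit interval.\<close>
  have pos: "c *\<^sub>R X \<in> group_tangents G" if X: "X \<in> group_tangents G" and c: "0 < c" for c X
  proof -
    obtain k where k: "c \<le> real k" using real_arch_simple by blast
    with c have "(c / real k) *\<^sub>R (real k *\<^sub>R X) \<in> group_tangents G"
      by (intro small nat X) auto
    then show ?thesis using k c by simp
  qed
  have "c *\<^sub>R X \<in> group_tangents G" if X: "X \<in> group_tangents G" for c X
  proof (cases "c = 0")
    case False
    then show ?thesis
      using pos[OF X, of c] group_tangents_uminus[OF G pos[OF X, of "- c"]] by (cases "0 < c") auto
  qed (simp add: zero)
  then show ?thesis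
    using zero group_tangents_add[OF G] by (auto simp: subspace_def)
qed

text \<open>Otherwise there are group elements tending to the identity whose secant directions stay away
  from the tangent space, although every accumulation point of these directions is tangent.\<close>
lemma group_tangents_approx:
  assumes G: "closed_orthogonal_group (G::(real^'n^'n) set)" and e: "0 < e"
  shows "\<exists>\<rho>>0. \<forall>A\<in>G. norm (A - mat 1) \<le> \<rho> \<longrightarrow>
           (\<exists>X\<in>group_tangents G. norm (A - mat 1 - X) \<le> e * norm (A - mat 1))"
proof (rule ccontr)
  assume con: "\<not> ?thesis"
  have "\<exists>A\<in>G. norm (A - mat 1) \<le> inverse (real (Suc n)) \<and>
      (\<forall>X\<in>group_tangents G. e * norm (A - mat 1) < norm (A - mat 1 - X))" for n
  proof -
    have "0 < inverse (real (Suc n))" by simp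
    then show ?thesis using con by (meson not_le)
  qed
  then obtain A where A: "\<And>n. A n \<in> G" "\<And>n. norm (A n - mat 1) \<le> inverse (real (Suc n))"
    "\<And>n X. X \<in> group_tangents G \<Longrightarrow> e * norm (A n - mat 1) < norm (A n - mat 1 - X)"
    by metis
  have ne: "A n \<noteq> mat 1" for n
    using A(3)[of 0 n] subspace_0[OF subspace_group_tangents[OF G]] by auto
  have "(\<lambda>n. A n - mat 1) \<longlonglongrightarrow> 0"
    by (rule Lim_null_comparison[OF _ LIMSEQ_inverse_real_of_nat]) (use A(2) in auto)
  then have lim: "A \<longlonglongrightarrow> mat 1" by (simp add: LIM_zero_iff)
  define U where "U n = (A n - mat 1) /\<^sub>R norm (A n - mat 1)" for n
  have Us: "U n \<in> sphere 0 1" for n using ne[of n] by (simp add: U_def)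
  obtain X r where X: "strict_mono r" "(U \<circ> r) \<longlonglongrightarrow> X"
    unfolding o_def by (rule compact_subsequence[OF compact_sphere Us])
  have "\<exists>B\<in>G. norm (B - mat 1 - s *\<^sub>R X) \<le> 1 * s\<^sup>2" if "0 < s" for s
    using secant_limit[OF G, of "A \<circ> r" X s] A(1) ne LIMSEQ_subseq_LIMSEQ[OF lim X(1)] X(2) that
    by (simp add: U_def o_def)
  then have XT: "X \<in> group_tangents G" unfolding group_tangents_def by blast
  have "e < norm ((U \<circ> r) n - X)" for n
  proof -
    let ?t = "norm (A (r n) - mat 1)"
    have t: "0 < ?t" using ne[of "r n"] by simp
    have "e * ?t < norm (A (r n) - mat 1 - ?t *\<^sub>R X)"
      by (intro A(3) subspace_scale[OF subspace_group_tangents[OF G]] XT)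
    also have "A (r n) - mat 1 - ?t *\<^sub>R X = ?t *\<^sub>R (U (r n) - X)"
      using t by (simp add: U_def scaleR_diff_right)
    finally show ?thesis using t by (simp add: mult.commute)
  qed
  moreover have "\<forall>\<^sub>F n in sequentially. dist ((U \<circ> r) n) X < e"
    using X(2) e by (rule tendstoD)
  ultimately show False
    using eventually_happens'[OF sequentially_bot, of "\<lambda>n. dist ((U \<circ> r) n) X < e"]
    by (metis dist_norm less_asym)
qed

text \<open>The error of first order in \<open>group_tangents_approx\<close> improves itself. Let \<open>X + Z\<close> be the
  splitting of \<open>A - mat 1\<close> into tangent and normal part, and let \<open>B\<close> in \<open>G\<close> approximate \<open>mat 1 + X\<close>. Then
  \<open>B\<inverse> A - mat 1\<close> is \<open>Z\<close> up to second order, and it is nearly tangent as well, so that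
  \<open>Z\<close> itself has second order.\<close>
lemma group_tangents_quadratic:
  assumes G: "closed_orthogonal_group (G::(real^'n^'n) set)"
  shows "\<exists>\<rho>>0. \<forall>A\<in>G. norm (A - mat 1) \<le> \<rho> \<longrightarrow>
           (\<exists>X\<in>group_tangents G. norm X \<le> norm (A - mat 1) \<and>
              norm (A - mat 1 - X) \<le> 3 * (norm (A - mat 1))\<^sup>2)"
proof -
  let ?T = "group_tangents G"
  have T: "span ?T = ?T" using subspace_group_tangents[OF G] by (simp add: span_eq_iff)
  obtain \<rho> where \<rho>: "\<rho> > 0" "\<And>A. A \<in> G \<Longrightarrow> norm (A - mat 1) \<le> \<rho> \<Longrightarrow>
           (\<exists>X\<in>?T. norm (A - mat 1 - X) \<le> 1/4 * norm (A - mat 1))"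
    using group_tangents_approx[OF G, of "1/4"] by auto
  have "\<exists>X\<in>?T. norm X \<le> norm (A - mat 1) \<and> norm (A - mat 1 - X) \<le> 3 * (norm (A - mat 1))\<^sup>2"
    if A: "A \<in> G" "norm (A - mat 1) \<le> min (1/8) (\<rho> / 3)" for A
  proof -
    let ?a = "norm (A - mat 1)"
    obtain X Z where XZ: "X \<in> ?T" "\<And>w. w \<in> ?T \<Longrightarrow> orthogonal Z w" "A - mat 1 = X + Z"
      using orthogonal_subspace_decomp_exists[of ?T "A - mat 1"] T by metis
    have Xa: "norm X \<le> ?a" and Za: "norm Z \<le> ?a"
      using norm_add_Pythagorean[of X Z] XZ by (auto simp: orthogonal_commute intro: power2_le_imp_le)
    have near: "norm Z \<le> norm (Z - w)" if "w \<in> ?T" for w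
    proof -
      have "orthogonal Z (- w)" using XZ(2)[OF that] by (simp add: orthogonal_def)
      from norm_add_Pythagorean[OF this] show ?thesis by (auto intro: power2_le_imp_le)
    qed
    \<comment> \<open>The group element \<open>B\<close> has the same tangential part as \<open>A\<close> up to second order.\<close>
    obtain B where B: "B \<in> G" "norm (B - mat 1 - X) \<le> (norm X)\<^sup>2"
      using group_tangents_exp[OF G XZ(1)] by blast
    have a2: "?a\<^sup>2 \<le> ?a / 8" using A(2) mult_left_mono[of ?a "1/8" ?a] by (simp add: power2_eq_square)
    have X2: "(norm X)\<^sup>2 \<le> ?a\<^sup>2" using Xa by simp
    have Bt: "transpose B \<in> G" "orthogonal_matrix (transpose B)" "transpose B ** B = mat 1"
      using closed_orthogonal_groupD[OF G] B(1) by (auto simp: orthogonal_matrix_def)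
    let ?D = "transpose B ** A"
    have D1: "?D - mat 1 = transpose B ** (A - B)" by (simp add: matrix_mul_diff_right Bt)
    have AB: "A - B = Z - (B - mat 1 - X)" using XZ(3) by (simp add: algebra_simps)
    have nAB: "norm (A - B) \<le> norm Z + ?a\<^sup>2"
      unfolding AB using B(2) X2 norm_triangle_ineq4[of Z "B - mat 1 - X"] by linarith
    have nD: "norm (?D - mat 1) = norm (A - B)"
      unfolding D1 by (rule norm_orthogonal_mul_left[OF Bt(2)])
    have "norm (?D - mat 1) \<le> \<rho>"
      unfolding nD using nAB Za a2 A(2) norm_ge_zero[of "A - mat 1"] unfolding min.bounded_iff by linarith
    then obtain X' where X': "X' \<in> ?T" "norm (?D - mat 1 - X') \<le> 1/4 * norm (A - B)"
      using \<rho>(2)[of ?D] nD closed_orthogonal_groupD(3)[OF G Bt(1) A(1)] by auto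
    have nB1: "norm (transpose B - mat 1) \<le> 2 * ?a"
    proof -
      have "norm (transpose B - mat 1) = norm (B - mat 1)"
        by (metis norm_transpose transpose_diff transpose_mat)
      also have "\<dots> \<le> (norm X)\<^sup>2 + norm X"
        using B(2) norm_triangle_ineq[of "B - mat 1 - X" X] by simp
      also have "\<dots> \<le> 2 * ?a" using X2 Xa a2 norm_ge_zero[of "A - mat 1"] by linarith
      finally show ?thesis .
    qed
    have "norm ((transpose B - mat 1) ** (A - B)) \<le> (2 * ?a) * norm (A - B)"
      using norm_matrix_mul[of "transpose B - mat 1" "A - B"] nB1
      by (meson mult_right_mono norm_ge_zero order_trans)
    also have "\<dots> \<le> 1/4 * norm (A - B)"
      using A(2) by (intro mult_right_mono) auto
    finally have c: "norm ((transpose B - mat 1) ** (A - B)) \<le> 1/4 * norm (A - B)" .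
    have "Z - X' = (?D - mat 1 - X') - (transpose B - mat 1) ** (A - B) + (B - mat 1 - X)"
      unfolding D1 using AB by (simp add: matrix_mul_diff_left algebra_simps)
    then have "norm (Z - X') \<le> 1/4 * norm (A - B) + 1/4 * norm (A - B) + ?a\<^sup>2"
      using X'(2) c B(2) X2 by (smt (verit) norm_triangle_ineq norm_triangle_ineq4)
    then have "norm Z \<le> 3 * ?a\<^sup>2" using near[OF X'(1)] nAB by simp
    then show ?thesis using XZ(1,3) Xa by auto
  qed
  moreover have "0 < min (1/8) (\<rho> / 3)" using \<rho>(1) by simp
  ultimately show ?thesis by blast
qed

text \<open>An approximate square root of \<open>A\<close> within the group, that is, an approximate midpoint between the
  identity and \<open>A\<close>.\<close>
lemma group_halving:
  assumes G: "closed_orthogonal_group (G::(real^'n^'n) set)"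
    and X: "X \<in> group_tangents G" "norm X \<le> norm (A - mat 1)"
      "norm (A - mat 1 - X) \<le> 3 * (norm (A - mat 1))\<^sup>2"
  shows "\<exists>B\<in>G. norm (B - (1/2) *\<^sub>R (mat 1 + A)) \<le> 3 * (norm (A - mat 1))\<^sup>2"
proof -
  have "(1/2) *\<^sub>R X \<in> group_tangents G"
    by (intro subspace_scale[OF subspace_group_tangents[OF G]] X)
  then obtain B where B: "B \<in> G" "norm (B - mat 1 - (1/2) *\<^sub>R X) \<le> (norm ((1/2) *\<^sub>R X))\<^sup>2"
    using group_tangents_exp[OF G] by blast
  have "B - (1/2) *\<^sub>R (mat 1 + A) = (B - mat 1 - (1/2) *\<^sub>R X) - (1/2) *\<^sub>R (A - mat 1 - X)"
    by (simp add: vec_eq_iff field_simps)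
  then have "norm (B - (1/2) *\<^sub>R (mat 1 + A)) \<le>
      norm (B - mat 1 - (1/2) *\<^sub>R X) + norm ((1/2) *\<^sub>R (A - mat 1 - X))"
    by (metis norm_triangle_ineq4)
  also have "\<dots> \<le> (norm X)\<^sup>2 / 4 + (3/2) * (norm (A - mat 1))\<^sup>2"
    using B(2) X(3) by (simp add: power2_eq_square)
  also have "\<dots> \<le> 3 * (norm (A - mat 1))\<^sup>2"
    using power_mono[OF X(2), of 2] zero_le_power2[of "norm (A - mat 1)"] norm_ge_zero[of X]
    by linarith
  finally show ?thesis using B(1) by blast
qed

section \<open>Subgroups near a closed subgroup are subconjugate to it\<close>

text \<open>First variation. Since all elements of \<open>G\<close> have the same norm, the hypothesis on \<open>W\<close> says that the
  identity is a point of \<open>G\<close> nearest to \<open>W\<close>.\<close>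
lemma group_tangents_orthogonal_to_nearest:
  assumes G: "closed_orthogonal_group (G::(real^'n^'n) set)"
    and W: "\<And>g. g \<in> G \<Longrightarrow> g \<bullet> W \<le> mat 1 \<bullet> W"
    and X: "X \<in> group_tangents G"
  shows "X \<bullet> W = 0"
proof -
  have le: "Z \<bullet> W \<le> 0" if Z: "Z \<in> group_tangents G" for Z
  proof -
    have bound: "Z \<bullet> W \<le> t * ((norm Z)\<^sup>2 * norm W)" if t: "0 < t" for t
    proof -
      obtain g where g: "g \<in> G" "norm (g - mat 1 - t *\<^sub>R Z) \<le> (norm (t *\<^sub>R Z))\<^sup>2"
        using group_tangents_exp[OF G subspace_scale[OF subspace_group_tangents[OF G] Z]] by blast
      have "t * (Z \<bullet> W) = (g - mat 1) \<bullet> W - (g - mat 1 - t *\<^sub>R Z) \<bullet> W"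
        by (simp add: inner_diff_left)
      also have "\<dots> \<le> 0 + norm (g - mat 1 - t *\<^sub>R Z) * norm W"
        using W[OF g(1)] Cauchy_Schwarz_ineq2[of "g - mat 1 - t *\<^sub>R Z" W]
        by (simp only: inner_diff_left)
      also have "\<dots> \<le> (norm (t *\<^sub>R Z))\<^sup>2 * norm W"
        using g(2) by (simp add: mult_right_mono)
      also have "\<dots> = t * (t * ((norm Z)\<^sup>2 * norm W))"
        by (simp add: power2_eq_square)
      finally show ?thesis using t by simp
    qed
    let ?c = "(norm Z)\<^sup>2 * norm W"
    have c: "0 \<le> ?c" by simp
    show ?thesis
    proof (rule field_le_epsilon)
      fix e :: real assume e: "0 < e"
      have "Z \<bullet> W \<le> e / (?c + 1) * ?c" by (rule bound) (use e c in \<open>intro divide_pos_pos, linarith+\<close>)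
      also have "\<dots> \<le> 0 + e" using e c by (simp add: field_simps del: mult_nonneg_nonneg)
      finally show "Z \<bullet> W \<le> 0 + e" .
    qed
  qed
  from le[OF X] le[OF group_tangents_uminus[OF G X]] show ?thesis by simp
qed

lemma group_tangents_orthogonal_to_one:
  assumes G: "closed_orthogonal_group (G::(real^'n^'n) set)" and X: "X \<in> group_tangents G"
  shows "X \<bullet> mat 1 = 0"
proof (rule group_tangents_orthogonal_to_nearest[OF G _ X])
  fix g assume "g \<in> G"
  then show "g \<bullet> mat 1 \<le> mat 1 \<bullet> (mat 1::real^'n^'n)"
    using norm_cauchy_schwarz[of g "mat 1"] norm_orthogonal_matrix closed_orthogonal_groupD(1)[OF G]
    by (metis dot_square_norm power2_eq_square)
qed

lemma inner_le_of_norm_diff_le: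
  fixes x y z :: "'a::real_inner"
  assumes "norm (z - x) \<le> norm (z - y)" "norm x = norm y"
  shows "y \<bullet> z \<le> x \<bullet> z"
proof -
  have "(norm (z - x))\<^sup>2 \<le> (norm (z - y))\<^sup>2" using assms(1) by simp
  moreover have "x \<bullet> x = y \<bullet> y" using assms(2) by (metis dot_square_norm)
  ultimately show ?thesis by (simp add: power2_norm_eq_inner inner_diff inner_commute)
qed

lemma norm_midpoint_square:
  fixes u v :: "'a::real_inner"
  shows "(norm ((1/2) *\<^sub>R u + (1/2) *\<^sub>R v))\<^sup>2 = (norm u)\<^sup>2 / 2 + (norm v)\<^sup>2 / 2 - (norm (v - u))\<^sup>2 / 4"
  by (simp add: power2_norm_eq_inner inner_simps inner_commute field_simps)

text \<open>Here \<open>s\<close> is the sum of the squares of two sides of a thin parallelogram, \<open>u\<close> the length of a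
  median, \<open>e\<close> the error made by replacing
  midpoints of matrices by group elements, and \<open>s / 8\<close> the gain from the parallelogram law.\<close>
lemma coset_midpoint_gain:
  fixes r s u e :: real
  assumes "0 \<le> r" "r \<le> 1/100" "0 \<le> s" "s \<le> 20 * r\<^sup>2" "0 \<le> u" "u\<^sup>2 \<le> r\<^sup>2 - s / 8" "0 \<le> e" "e \<le> 3 * s"
  shows "(u + e)\<^sup>2 \<le> r\<^sup>2 - s / 25"
proof -
  have "u\<^sup>2 \<le> r\<^sup>2" using assms by linarith
  then have "u \<le> r" using assms by (simp add: power2_le_iff_abs_le)
  have "2 * (u * e) \<le> 2 * (r * (3 * s))"
    using \<open>u \<le> r\<close> assms by (intro mult_left_mono mult_mono) auto
  also have "\<dots> \<le> 2 * (1/100 * (3 * s))"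
    using assms by (intro mult_left_mono mult_right_mono) auto
  finally have 1: "2 * (u * e) \<le> 6/100 * s" by simp
  have "r\<^sup>2 \<le> (1/100)\<^sup>2" using assms by (intro power_mono) auto
  then have "s \<le> 20 / 10000" using assms by (simp add: power2_eq_square)
  have "e\<^sup>2 \<le> (3 * s)\<^sup>2" using assms by (intro power_mono) auto
  also have "\<dots> = 9 * (s * s)" by (simp add: power2_eq_square)
  also have "\<dots> \<le> 9 * (20 / 10000 * s)"
    using \<open>s \<le> 20 / 10000\<close> assms by (intro mult_left_mono mult_right_mono) auto
  finally have 2: "e\<^sup>2 \<le> 18/1000 * s" by simp
  have "(u + e)\<^sup>2 = u\<^sup>2 + 2 * (u * e) + e\<^sup>2" by (simp add: power2_eq_square algebra_simps)
  then show ?thesis using 1 2 assms by linarith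
qed

text \<open>Uniform convexity of small balls in \<open>\<Gamma> / G\<close>. The cosets of the identity and of \<open>Y\<close> are the two
  centres, and \<open>Y\<close> is chosen in its coset nearest to the identity. If the coset of \<open>Z\<close> is within \<open>r\<close> of
  both, then it is closer than \<open>r\<close>, by an amount independent of \<open>Z\<close>, to an approximate midpoint
  \<open>N\<close>. This is the parallelogram law: the error of all replacements of midpoints
  by group elements is quadratic in the sides, multiplied by \<open>r\<close>, and small against
  the gain.\<close>
lemma coset_midpoint:
  assumes G: "closed_orthogonal_group (G::(real^'n^'n) set)"
    and \<Gamma>: "closed_orthogonal_group \<Gamma>" and sub: "G \<subseteq> \<Gamma>"
  shows "\<exists>\<epsilon>>0. \<forall>Y\<in>\<Gamma>. \<forall>r\<le>\<epsilon>. norm (Y - mat 1) \<le> 2 * r \<longrightarrow>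
     (\<forall>g\<in>G. norm (Y - mat 1) \<le> norm (Y ** g - mat 1)) \<longrightarrow>
     (\<exists>N\<in>\<Gamma>. \<forall>Z\<in>\<Gamma>. \<forall>g\<in>G. norm (Z - mat 1) \<le> r \<longrightarrow> norm (Z ** g - Y) \<le> r \<longrightarrow>
        (\<exists>h\<in>G. (norm (Z ** h - N))\<^sup>2 \<le> r\<^sup>2 - (norm (Y - mat 1))\<^sup>2 / 25))"
proof -
  obtain \<rho> where \<rho>: "\<rho> > 0" "\<And>A. A \<in> G \<Longrightarrow> norm (A - mat 1) \<le> \<rho> \<Longrightarrow>
           (\<exists>X\<in>group_tangents G. norm X \<le> norm (A - mat 1) \<and>
              norm (A - mat 1 - X) \<le> 3 * (norm (A - mat 1))\<^sup>2)"
    using group_tangents_quadratic[OF G] by blast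
  obtain \<sigma> where \<sigma>: "\<sigma> > 0" "\<And>A. A \<in> \<Gamma> \<Longrightarrow> norm (A - mat 1) \<le> \<sigma> \<Longrightarrow>
           (\<exists>X\<in>group_tangents \<Gamma>. norm X \<le> norm (A - mat 1) \<and>
              norm (A - mat 1 - X) \<le> 3 * (norm (A - mat 1))\<^sup>2)"
    using group_tangents_quadratic[OF \<Gamma>] by blast
  \<comment> \<open>The quarters make the tangent approximations valid within \<open>4 * r\<close> of the identity, and \<open>1/100\<close> lets the gain outweigh the errors.\<close>
  define \<epsilon> where "\<epsilon> = min (1/100) (min (\<rho>/4) (\<sigma>/4))"
  have "\<exists>N\<in>\<Gamma>. \<forall>Z\<in>\<Gamma>. \<forall>g\<in>G. norm (Z - mat 1) \<le> r \<longrightarrow> norm (Z ** g - Y) \<le> r \<longrightarrow>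
        (\<exists>h\<in>G. (norm (Z ** h - N))\<^sup>2 \<le> r\<^sup>2 - (norm (Y - mat 1))\<^sup>2 / 25)"
    if Y: "Y \<in> \<Gamma>" and r\<epsilon>: "r \<le> \<epsilon>" and Yr: "norm (Y - mat 1) \<le> 2 * r"
      and near: "\<And>g. g \<in> G \<Longrightarrow> norm (Y - mat 1) \<le> norm (Y ** g - mat 1)" for Y r
  proof -
    let ?d = "norm (Y - mat 1)"
    have r: "0 \<le> r" "r \<le> 1/100" "4 * r \<le> \<rho>" "4 * r \<le> \<sigma>"
      using r\<epsilon> Yr norm_ge_zero[of "Y - mat 1"] unfolding \<epsilon>_def by linarith+
    have oY: "orthogonal_matrix Y" "Y ** transpose Y = mat 1"
      using closed_orthogonal_groupD(1)[OF \<Gamma> Y] by (auto simp: orthogonal_matrix_def)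
    obtain X0 where X0: "X0\<in>group_tangents \<Gamma>" "norm X0 \<le> ?d" "norm (Y - mat 1 - X0) \<le> 3 * ?d\<^sup>2"
      using \<sigma>(2)[OF Y] Yr r by force
    obtain N where N: "N \<in> \<Gamma>" "norm (N - (1/2) *\<^sub>R (mat 1 + Y)) \<le> 3 * ?d\<^sup>2"
      using group_halving[OF \<Gamma> X0] by blast
    have perp: "\<bar>X \<bullet> (Y - mat 1)\<bar> \<le> norm X * ?d\<^sup>2" if X: "X \<in> group_tangents G" for X
    proof -
      have "g \<bullet> transpose Y \<le> mat 1 \<bullet> transpose Y" if g: "g \<in> G" for g
      proof -
        have og: "orthogonal_matrix g" by (rule closed_orthogonal_groupD(1)[OF G g])
        have "norm (transpose Y - mat 1) \<le> norm (transpose Y - g)"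
          using near[OF g] norm_orthogonal_mul_left[OF oY(1), of "transpose Y - g"] oY(2)
          by (metis matrix_mul_diff_right norm_minus_commute norm_transpose transpose_diff transpose_mat)
        then show ?thesis
          by (rule inner_le_of_norm_diff_le) (simp add: norm_orthogonal_matrix[OF og])
      qed
      then have "X \<bullet> transpose Y = 0"
        using group_tangents_orthogonal_to_nearest[OF G _ X] by blast
      \<comment> \<open>The inverse of \<open>Y\<close> is exactly orthogonal to \<open>X\<close>; passing to \<open>Y\<close> costs a term of second order.\<close>
      then have "X \<bullet> (Y - mat 1) = X \<bullet> ((Y - mat 1) + (transpose Y - mat 1))"
        using group_tangents_orthogonal_to_one[OF G X] by (simp only: inner_add_right inner_diff_right)
      also have "(Y - mat 1) + (transpose Y - mat 1) = - ((Y - mat 1) ** transpose (Y - mat 1))"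
        by (simp add: matrix_mul_diff_left matrix_mul_diff_right transpose_diff transpose_mat oY(2))
      finally have "X \<bullet> (Y - mat 1) = - (X \<bullet> ((Y - mat 1) ** transpose (Y - mat 1)))" by simp
      then have "\<bar>X \<bullet> (Y - mat 1)\<bar> \<le> norm X * norm ((Y - mat 1) ** transpose (Y - mat 1))"
        using Cauchy_Schwarz_ineq2[of X "(Y - mat 1) ** transpose (Y - mat 1)"] by simp
      also have "\<dots> \<le> norm X * ?d\<^sup>2"
        using norm_matrix_mul[of "Y - mat 1" "transpose (Y - mat 1)"]
        by (intro mult_left_mono) (auto simp: power2_eq_square)
      finally show ?thesis .
    qed
    have "\<exists>h\<in>G. (norm (Z ** h - N))\<^sup>2 \<le> r\<^sup>2 - ?d\<^sup>2 / 25"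
      if Z: "Z \<in> \<Gamma>" and g: "g \<in> G" and Z1: "norm (Z - mat 1) \<le> r" and ZY: "norm (Z ** g - Y) \<le> r" for Z g
    proof -
      have oZ: "orthogonal_matrix Z" by (rule closed_orthogonal_groupD(1)[OF \<Gamma> Z])
      let ?a = "norm (g - mat 1)"
      have Zg: "Z ** (g - mat 1) = (Z ** g - Y) + (Y - mat 1) - (Z - mat 1)"
        by (simp add: matrix_mul_diff_right)
      have nZg: "norm (Z ** (g - mat 1)) = ?a" by (rule norm_orthogonal_mul_left[OF oZ])
      have a: "?a \<le> 4 * r"
        using nZg ZY Yr Z1 unfolding Zg
        by (smt (verit) norm_triangle_ineq norm_triangle_ineq4)
      obtain X where X: "X\<in>group_tangents G" "norm X \<le> ?a" "norm (g - mat 1 - X) \<le> 3 * ?a\<^sup>2"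
        using \<rho>(2)[OF g] a r by force
      obtain h where h: "h \<in> G" "norm (h - (1/2) *\<^sub>R (mat 1 + g)) \<le> 3 * ?a\<^sup>2"
        using group_halving[OF G X] by blast
      \<comment> \<open>The median \<open>U\<close> of the flat triangle, and the error \<open>E\<close> of replacing flat midpoints by group elements.\<close>
      define U where "U = (1/2) *\<^sub>R (Z - mat 1) + (1/2) *\<^sub>R (Z ** g - Y)"
      define E where "E = Z ** (h - (1/2) *\<^sub>R (mat 1 + g)) - (N - (1/2) *\<^sub>R (mat 1 + Y))"
      have ZhN: "Z ** h - N = U + E"
        unfolding U_def E_def
        by (simp add: matrix_mul_diff_right matrix_add_ldistrib matrix_mul_scaleR_right algebra_simps)
      have E: "norm E \<le> 3 * (?a\<^sup>2 + ?d\<^sup>2)"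
        unfolding E_def using h(2) N(2) norm_orthogonal_mul_left[OF oZ, of "h - (1/2) *\<^sub>R (mat 1 + g)"]
        by (smt (verit) norm_triangle_ineq4 distrib_left)
      \<comment> \<open>The sides of the parallelogram are nearly orthogonal: \<open>g - mat 1\<close> is nearly tangent and \<open>Y - mat 1\<close> nearly normal to \<open>G\<close>.\<close>
      have cross: "\<bar>(Z ** (g - mat 1)) \<bullet> (Y - mat 1)\<bar> \<le> 18 * r * (?a * ?d)"
      proof -
        let ?P = "(Z - mat 1) ** (g - mat 1)" and ?Q = "g - mat 1 - X"
        have "Z ** (g - mat 1) = ?P + ?Q + X" by (simp add: matrix_mul_diff_left)
        then have "\<bar>(Z ** (g - mat 1)) \<bullet> (Y - mat 1)\<bar> \<le>
            \<bar>?P \<bullet> (Y - mat 1)\<bar> + \<bar>?Q \<bullet> (Y - mat 1)\<bar> + \<bar>X \<bullet> (Y - mat 1)\<bar>"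
          by (simp only: inner_add_left)
        also have "\<dots> \<le> norm ?P * ?d + norm ?Q * ?d + norm X * ?d\<^sup>2"
          by (intro add_mono perp X Cauchy_Schwarz_ineq2)
        also have "\<dots> \<le> (r * ?a) * ?d + (12 * r * ?a) * ?d + (2 * r * ?a) * ?d"
        proof (intro add_mono mult_right_mono)
          show "norm ?P \<le> r * ?a"
            using norm_matrix_mul[of "Z - mat 1" "g - mat 1"] Z1
            by (meson mult_right_mono norm_ge_zero order_trans)
          have "3 * ?a\<^sup>2 \<le> 3 * (4 * r * ?a)"
            unfolding power2_eq_square using a by (intro mult_left_mono mult_right_mono) auto
          then show "norm ?Q \<le> 12 * r * ?a" using X(3) by simp
          have "norm X * ?d\<^sup>2 \<le> ?a * (2 * r * ?d)"
            unfolding power2_eq_square using X(2) Yr by (intro mult_mono mult_right_mono) (auto simp: r)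
          then show "norm X * ?d\<^sup>2 \<le> 2 * r * ?a * ?d" by (simp add: mult_ac)
        qed auto
        also have "\<dots> \<le> 18 * r * (?a * ?d)"
          using r(1) by (simp add: algebra_simps)
        finally show ?thesis .
      qed
      have arith: "(x + y) / 2 \<le> L"
        if "L = x + y - 2 * i" "m' \<le> 18 * (1/100) * m" "2 * m \<le> x + y" "\<bar>i\<bar> \<le> m'" "0 \<le> x" "0 \<le> y"
        for x y L i m m' :: real
      proof -
        have "i \<le> m'" using that(4) by linarith
        then show ?thesis using that by argo
      qed
      have "(norm (Z ** (g - mat 1) - (Y - mat 1)))\<^sup>2 =
          ?a\<^sup>2 + ?d\<^sup>2 - 2 * ((Z ** (g - mat 1)) \<bullet> (Y - mat 1))"
        unfolding nZg[symmetric] by (simp add: power2_norm_eq_inner inner_diff inner_commute)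
      moreover have "18 * r * (?a * ?d) \<le> 18 * (1/100) * (?a * ?d)"
        using r by (intro mult_right_mono mult_left_mono) auto
      moreover have "2 * (?a * ?d) \<le> ?a\<^sup>2 + ?d\<^sup>2"
        using sum_squares_bound[of ?a ?d] by (simp add: mult_ac)
      ultimately have "(norm (Z ** (g - mat 1) - (Y - mat 1)))\<^sup>2 \<ge> (?a\<^sup>2 + ?d\<^sup>2) / 2"
        by (rule arith) (use cross in auto)
      moreover have "Z ** (g - mat 1) - (Y - mat 1) = (Z ** g - Y) - (Z - mat 1)"
        by (simp add: matrix_mul_diff_right)
      ultimately have diff: "(norm ((Z ** g - Y) - (Z - mat 1)))\<^sup>2 \<ge> (?a\<^sup>2 + ?d\<^sup>2) / 2" by simp
      have "(norm (Z - mat 1))\<^sup>2 \<le> r\<^sup>2" "(norm (Z ** g - Y))\<^sup>2 \<le> r\<^sup>2"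
        using Z1 ZY by (auto intro: power_mono)
      then have U: "(norm U)\<^sup>2 \<le> r\<^sup>2 - (?a\<^sup>2 + ?d\<^sup>2) / 8"
        unfolding U_def norm_midpoint_square using diff by linarith
      have "?a\<^sup>2 + ?d\<^sup>2 \<le> (4 * r)\<^sup>2 + (2 * r)\<^sup>2"
        using a Yr by (intro add_mono power_mono) auto
      then have s: "?a\<^sup>2 + ?d\<^sup>2 \<le> 20 * r\<^sup>2" by (simp add: power_mult_distrib)
      have "(norm (Z ** h - N))\<^sup>2 \<le> (norm U + norm E)\<^sup>2"
        unfolding ZhN by (intro power_mono norm_triangle_ineq) auto
      also have "\<dots> \<le> r\<^sup>2 - (?a\<^sup>2 + ?d\<^sup>2) / 25"
        by (rule coset_midpoint_gain) (use r s U E in auto)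
      also have "\<dots> \<le> r\<^sup>2 - ?d\<^sup>2 / 25" by simp
      finally show ?thesis using h(1) by blast
    qed
    then show ?thesis using N(1) by blast
  qed
  moreover have "\<epsilon> > 0" unfolding \<epsilon>_def using \<rho>(1) \<sigma>(1) by simp
  ultimately show ?thesis by blast
qed

text \<open>The theorem of Montgomery and Zippin for groups of orthogonal matrices. The subgroup \<open>K\<close> acts on
  \<open>\<Gamma> / G\<close> by isometries. A circumcentre \<open>B0\<close> of the orbit of the base coset exists by
  compactness, and it is unique: if a translate \<open>k ** B0\<close> were in a different coset, their midpoint
  from \<open>coset_midpoint\<close> would be the centre of a smaller ball. Hence \<open>K\<close> fixes the coset of \<open>B0\<close>.\<close>
theorem near_subgroup_conjugate:
  assumes G: "closed_orthogonal_group (G::(real^'n^'n) set)"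
    and \<Gamma>: "closed_orthogonal_group \<Gamma>" and sub: "G \<subseteq> \<Gamma>"
  shows "\<exists>\<epsilon>>0. \<forall>K. K \<subseteq> \<Gamma> \<longrightarrow> mat 1 \<in> K \<longrightarrow> (\<forall>A\<in>K. \<forall>B\<in>K. A ** B \<in> K) \<longrightarrow>
     (\<forall>A\<in>K. transpose A \<in> K) \<longrightarrow> (\<forall>k\<in>K. \<exists>g\<in>G. norm (k - g) \<le> \<epsilon>) \<longrightarrow>
     (\<exists>B\<in>\<Gamma>. \<forall>k\<in>K. transpose B ** k ** B \<in> G)"
proof -
  obtain \<epsilon> where \<epsilon>: "\<epsilon> > 0" and mid: "\<And>Y r. Y \<in> \<Gamma> \<Longrightarrow> r \<le> \<epsilon> \<Longrightarrow> norm (Y - mat 1) \<le> 2 * r \<Longrightarrow>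
     (\<And>g. g \<in> G \<Longrightarrow> norm (Y - mat 1) \<le> norm (Y ** g - mat 1)) \<Longrightarrow>
     (\<exists>N\<in>\<Gamma>. \<forall>Z\<in>\<Gamma>. \<forall>g\<in>G. norm (Z - mat 1) \<le> r \<longrightarrow> norm (Z ** g - Y) \<le> r \<longrightarrow>
        (\<exists>h\<in>G. (norm (Z ** h - N))\<^sup>2 \<le> r\<^sup>2 - (norm (Y - mat 1))\<^sup>2 / 25))"
    using coset_midpoint[OF G \<Gamma> sub] by metis
  have main: "\<exists>B\<in>\<Gamma>. \<forall>k\<in>K. transpose B ** k ** B \<in> G"
    if K: "K \<subseteq> \<Gamma>" "mat 1 \<in> K" "\<And>A B. A \<in> K \<Longrightarrow> B \<in> K \<Longrightarrow> A ** B \<in> K"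
      "\<And>A. A \<in> K \<Longrightarrow> transpose A \<in> K" "\<And>k. k \<in> K \<Longrightarrow> \<exists>g\<in>G. norm (k - g) \<le> \<epsilon>" for K
  proof -
    note Gi = closed_orthogonal_groupD[OF G] and \<Gamma>i = closed_orthogonal_groupD[OF \<Gamma>]
    have og: "orthogonal_matrix A" "transpose A ** A = mat 1" "A ** transpose A = mat 1" if "A \<in> \<Gamma>" for A
      using \<Gamma>i(1)[OF that] by (auto simp: orthogonal_matrix_def)
    have cancel: "transpose A ** (A ** B) = B" "A ** (transpose A ** B) = B" if "A \<in> \<Gamma>" for A B :: "real^'n^'n"
      using og[OF that] by (simp_all add: matrix_mul_assoc)
    have attain: "\<exists>g\<in>G. norm (k ** g - B) \<le> t" if "infdist B ((**) k ` G) \<le> t" for k B :: "real^'n^'n" and t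
    proof -
      have "compact ((**) k ` G)"
        by (intro compact_continuous_image closed_orthogonal_group_compact G continuous_intros)
      then have "closed ((**) k ` G)" "(**) k ` G \<noteq> {}"
        using compact_imp_closed Gi(2) by auto
      then obtain x where "x \<in> (**) k ` G" "infdist B ((**) k ` G) = dist B x"
        by (rule infdist_attains_inf)
      then show ?thesis using that by (auto simp: dist_norm norm_minus_commute)
    qed
    have infdistI: "infdist B ((**) k ` G) \<le> t" if "g \<in> G" "norm (k ** g - B) \<le> t" for k B g :: "real^'n^'n" and t
      using infdist_le2[of "k ** g" "(**) k ` G" B t] that by (auto simp: dist_norm norm_minus_commute)
    \<comment> \<open>Pairs of a centre \<open>B\<close> and a radius such that the ball about the coset of \<open>B\<close> contains the orbit of the base coset.\<close>
    define C where "C = (\<Gamma> \<times> {0..\<epsilon>}) \<inter> (\<Inter>k\<in>K. {x. infdist (fst x) ((**) k ` G) \<le> snd x})"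
    have "compact C"
      unfolding C_def
      by (intro compact_Int_closed compact_Times closed_orthogonal_group_compact \<Gamma> compact_Icc
            closed_INT ballI closed_Collect_le continuous_intros)
    moreover have "(mat 1, \<epsilon>) \<in> C"
    proof -
      have "infdist (mat 1) ((**) k ` G) \<le> \<epsilon>" if k: "k \<in> K" for k
      proof -
        obtain g where g: "g \<in> G" "norm (k - g) \<le> \<epsilon>" using K(5)[OF k] by blast
        have "k ** transpose g - mat 1 = (k - g) ** transpose g"
          using og(3)[of g] g(1) sub by (auto simp: matrix_mul_diff_left)
        then have "norm (k ** transpose g - mat 1) \<le> \<epsilon>"
          using g(2) norm_orthogonal_mul_right[OF Gi(1)[OF Gi(4)[OF g(1)]]] by metis
        then show ?thesis using infdistI Gi(4)[OF g(1)] by blast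
      qed
      then show ?thesis unfolding C_def using \<Gamma>i(2) \<epsilon> by auto
    qed
    ultimately obtain x where x: "x \<in> C" "\<And>y. y \<in> C \<Longrightarrow> snd x \<le> snd y"
      using continuous_attains_inf[of C snd] continuous_on_snd[OF continuous_on_id] by blast
    define B0 r where "B0 = fst x" and "r = snd x"
    have B0: "B0 \<in> \<Gamma>" "0 \<le> r" "r \<le> \<epsilon>" and B0K: "\<And>k. k \<in> K \<Longrightarrow> \<exists>g\<in>G. norm (k ** g - B0) \<le> r"
      using x(1) attain unfolding C_def B0_def r_def by auto
    have min: "r \<le> t" if "B \<in> \<Gamma>" "0 \<le> t" "t \<le> \<epsilon>" "\<And>k. k \<in> K \<Longrightarrow> \<exists>g\<in>G. norm (k ** g - B) \<le> t" for B t
      using x(2)[of "(B, t)"] infdistI that unfolding C_def r_def by fastforce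
    have "transpose B0 ** k ** B0 \<in> G" if k: "k \<in> K" for k
    proof -
      have k\<Gamma>: "k \<in> \<Gamma>" using k K(1) by blast
      let ?D = "transpose B0 ** k ** B0"
      have D: "?D \<in> \<Gamma>" by (intro \<Gamma>i B0(1) k\<Gamma>)
      \<comment> \<open>After translation by the inverse of \<open>B0\<close>, the matrix \<open>?D ** g\<close> represents the translated circumcentre, nearest to the identity in its coset.\<close>
      have "continuous_on G (\<lambda>g. norm (?D ** g - mat 1))"
        by (intro continuous_intros)
      moreover have "G \<noteq> {}" using Gi(2) by blast
      ultimately obtain g where g: "g \<in> G" "\<And>g'. g' \<in> G \<Longrightarrow> norm (?D ** g - mat 1) \<le> norm (?D ** g' - mat 1)"
        using continuous_attains_inf[OF closed_orthogonal_group_compact[OF G]] by blast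
      have g\<Gamma>: "g \<in> \<Gamma>" using g(1) sub by blast
      let ?Y = "?D ** g"
      have Y: "?Y \<in> \<Gamma>" by (intro \<Gamma>i D g\<Gamma>)
      have near: "norm (?Y - mat 1) \<le> norm (?Y ** g' - mat 1)" if "g' \<in> G" for g'
        using g(2)[OF Gi(3)[OF g(1) that]] by (simp add: matrix_mul_assoc)
      have Yr: "norm (?Y - mat 1) \<le> 2 * r"
      proof -
        obtain g1 where g1: "g1 \<in> G" "norm (k ** g1 - B0) \<le> r" using B0K[OF k] by blast
        obtain g2 where g2: "g2 \<in> G" "norm (g2 - B0) \<le> r" using B0K[OF K(2)] by auto
        have gg: "g1 \<in> \<Gamma>" "g2 \<in> \<Gamma>" using g1 g2 sub by auto
        let ?g = "transpose g2 ** g1"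
        have gG: "?g \<in> G" by (intro Gi g1 g2)
        have "?D ** ?g - mat 1 = transpose B0 ** (k ** ((B0 - g2) ** ?g) + (k ** g1 - B0))"
          using og[OF B0(1)] og[OF gg(2)] cancel[OF gg(2)]
          by (simp add: matrix_mul_diff_left matrix_mul_diff_right matrix_add_ldistrib matrix_mul_assoc[symmetric])
        then have "norm (?D ** ?g - mat 1) = norm (k ** ((B0 - g2) ** ?g) + (k ** g1 - B0))"
          using norm_orthogonal_mul_left[OF og(1)[OF \<Gamma>i(4)[OF B0(1)]]] by metis
        also have "\<dots> \<le> norm (k ** ((B0 - g2) ** ?g)) + norm (k ** g1 - B0)" by (rule norm_triangle_ineq)
        also have "norm (k ** ((B0 - g2) ** ?g)) = norm (g2 - B0)"
          using norm_orthogonal_mul_left[OF og(1)[OF k\<Gamma>]] norm_orthogonal_mul_right[OF Gi(1)[OF gG]]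
          by (metis norm_minus_commute)
        finally show ?thesis using g(2)[OF gG] g1(2) g2(2) by linarith
      qed
      obtain N where N: "N \<in> \<Gamma>" and Nm: "\<And>Z g'. Z \<in> \<Gamma> \<Longrightarrow> g' \<in> G \<Longrightarrow> norm (Z - mat 1) \<le> r \<Longrightarrow>
          norm (Z ** g' - ?Y) \<le> r \<Longrightarrow> \<exists>h\<in>G. (norm (Z ** h - N))\<^sup>2 \<le> r\<^sup>2 - (norm (?Y - mat 1))\<^sup>2 / 25"
        using mid[OF Y B0(3) Yr near] by blast
      \<comment> \<open>If the two circumcentres differed, this would give a ball about \<open>B0 ** N\<close> that contains the orbit and is smaller.\<close>
      have better: "\<exists>h\<in>G. (norm (k' ** h - B0 ** N))\<^sup>2 \<le> r\<^sup>2 - (norm (?Y - mat 1))\<^sup>2 / 25"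
        if k': "k' \<in> K" for k'
      proof -
        have k'\<Gamma>: "k' \<in> \<Gamma>" using k' K(1) by blast
        obtain g3 where g3: "g3 \<in> G" "norm (k' ** g3 - B0) \<le> r" using B0K[OF k'] by blast
        obtain g4 where g4: "g4 \<in> G" "norm (transpose k ** k' ** g4 - B0) \<le> r"
          using B0K[OF K(3)[OF K(4)[OF k] k']] by blast
        have gg: "g3 \<in> \<Gamma>" "g4 \<in> \<Gamma>" using g3 g4 sub by auto
        let ?Z = "transpose B0 ** k' ** g3"
        have Z: "?Z \<in> \<Gamma>" by (intro \<Gamma>i B0(1) k'\<Gamma> gg)
        have BT: "orthogonal_matrix (transpose B0)" using og(1)[OF \<Gamma>i(4)[OF B0(1)]] .
        have "?Z - mat 1 = transpose B0 ** (k' ** g3 - B0)"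
          using og[OF B0(1)] by (simp add: matrix_mul_diff_right matrix_mul_assoc)
        then have Z1: "norm (?Z - mat 1) \<le> r" using g3(2) norm_orthogonal_mul_left[OF BT] by metis
        let ?g = "transpose g3 ** (g4 ** g)"
        have gG: "?g \<in> G" by (intro Gi g3 g4 g(1))
        have "?Z ** ?g - ?Y = transpose B0 ** (k ** ((transpose k ** k' ** g4 - B0) ** g))"
          using cancel[OF gg(1)] cancel[OF k\<Gamma>]
          by (simp add: matrix_mul_diff_right matrix_mul_diff_left matrix_mul_assoc[symmetric])
        then have "norm (?Z ** ?g - ?Y) \<le> r"
          using g4(2) norm_orthogonal_mul_left[OF BT] norm_orthogonal_mul_left[OF og(1)[OF k\<Gamma>]]
            norm_orthogonal_mul_right[OF og(1)[OF g\<Gamma>]] by metis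
        then obtain h where h: "h \<in> G" "(norm (?Z ** h - N))\<^sup>2 \<le> r\<^sup>2 - (norm (?Y - mat 1))\<^sup>2 / 25"
          using Nm[OF Z gG Z1] by blast
        have "k' ** (g3 ** h) - B0 ** N = B0 ** (?Z ** h - N)"
          using cancel[OF B0(1)] by (simp add: matrix_mul_diff_right matrix_mul_assoc[symmetric])
        then have "norm (k' ** (g3 ** h) - B0 ** N) = norm (?Z ** h - N)"
          using norm_orthogonal_mul_left[OF og(1)[OF B0(1)]] by metis
        then show ?thesis using h Gi(3)[OF g3(1) h(1)] by metis
      qed
      have "?Y = mat 1"
      proof (rule ccontr)
        assume "?Y \<noteq> mat 1"
        then have d: "0 < norm (?Y - mat 1)" by simp
        let ?q = "r\<^sup>2 - (norm (?Y - mat 1))\<^sup>2 / 25"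
        have q0: "0 \<le> ?q" using better[OF K(2)] by (meson order_trans zero_le_power2)
        have "?q < r\<^sup>2" using d by simp
        then have q: "sqrt ?q < r" using B0(2) by (metis real_sqrt_less_iff real_sqrt_abs abs_of_nonneg)
        have "\<exists>h\<in>G. norm (k' ** h - B0 ** N) \<le> sqrt ?q" if "k' \<in> K" for k'
          using better[OF that] real_le_rsqrt by blast
        then have "r \<le> sqrt ?q"
          using min[of "B0 ** N" "sqrt ?q"] \<Gamma>i(3)[OF B0(1) N] q0 q B0(3) by force
        then show False using q by simp
      qed
      then have "?D = transpose g"
        by (metis cancel(2)[OF \<Gamma>i(4)[OF g\<Gamma>]] g\<Gamma> og(3) matrix_mul_assoc matrix_mul_lid matrix_mul_rid)
      then show ?thesis using Gi(4)[OF g(1)] by simp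
    qed
    then show ?thesis using B0(1) by blast
  qed
  show ?thesis
    by (intro exI[of _ \<epsilon>] conjI allI impI main \<epsilon>) simp_all
qed

section \<open>The splitting of the ambient space\<close>

lemma subspace_first_factor: "subspace (first_factor K)"
  by (auto simp: subspace_def first_factor_def)

lemma subspace_second_factor: "subspace (second_factor K)"
  by (auto simp: subspace_def second_factor_def)

lemma first_second_orthogonal:
  assumes "a \<in> first_factor K" "v \<in> second_factor K" shows "a \<bullet> v = 0"
  using assms by (auto simp: first_factor_def second_factor_def inner_vec_def intro!: sum.neutral)

lemma second_factor_iff: "v \<in> second_factor K \<longleftrightarrow> (\<forall>a\<in>first_factor K. a \<bullet> v = 0)"
proof
  assume v: "\<forall>a\<in>first_factor K. a \<bullet> v = 0"
  have "v $ i = 0" if "i \<in> K" for i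
  proof -
    have "axis i 1 \<in> first_factor K" using that by (auto simp: first_factor_def axis_def)
    then show ?thesis using v by (auto simp: inner_axis')
  qed
  then show "v \<in> second_factor K" by (simp add: second_factor_def)
qed (simp add: first_second_orthogonal)

lemma factor_decomposition:
  obtains a v where "a \<in> first_factor K" "v \<in> second_factor K" "x = a + v"
proof
  show "(\<chi> i. if i \<in> K then x $ i else 0) \<in> first_factor K" by (simp add: first_factor_def)
  show "(\<chi> i. if i \<in> K then 0 else x $ i) \<in> second_factor K" by (simp add: second_factor_def)
  show "x = (\<chi> i. if i \<in> K then x $ i else 0) + (\<chi> i. if i \<in> K then 0 else x $ i)"
    by (simp add: vec_eq_iff)
qed

lemma norm_factor_sum:
  assumes "a \<in> first_factor K" "v \<in> second_factor K"
  shows "(norm (a + v))\<^sup>2 = (norm a)\<^sup>2 + (norm v)\<^sup>2"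
  using first_second_orthogonal[OF assms] by (intro norm_add_Pythagorean) (simp add: orthogonal_def)

lemma infdist_first_factor:
  assumes a: "a \<in> first_factor K" and v: "v \<in> second_factor K"
  shows "infdist (a + v) (first_factor K) = norm v"
proof (rule antisym)
  show "infdist (a + v) (first_factor K) \<le> norm v"
    by (rule infdist_le2[OF a]) (simp add: dist_norm)
  show "norm v \<le> infdist (a + v) (first_factor K)"
  proof (subst infdist_notempty, use a in blast, rule cINF_greatest, use a in blast)
    fix b assume b: "b \<in> first_factor K"
    have "(norm v)\<^sup>2 \<le> (norm ((a - b) + v))\<^sup>2"
      using norm_factor_sum[OF subspace_diff[OF subspace_first_factor a b] v] by simp
    then have "norm v \<le> norm ((a - b) + v)" by (rule power2_le_imp_le) simp
    also have "(a - b) + v = a + v - b" by simp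
    finally show "norm v \<le> dist (a + v) b" by (simp add: dist_norm)
  qed
qed

text \<open>The orthogonal group of the second factor, acting on the whole space. It is the ambient group in
  which \<open>near_subgroup_conjugate\<close> is applied, so that the conjugating matrix respects the
  splitting.\<close>
definition fixing_group :: "'m::finite set \<Rightarrow> (real^'m^'m) set" where
  "fixing_group K = {Q. orthogonal_matrix Q \<and> (\<forall>a\<in>first_factor K. Q *v a = a)}"

lemma closed_orthogonal_group_fixing_group: "closed_orthogonal_group (fixing_group K)"
  unfolding closed_orthogonal_group_def
proof (intro conjI ballI)
  show "mat 1 \<in> fixing_group K" by (simp add: fixing_group_def orthogonal_matrix_id)
  fix A B assume A: "A \<in> fixing_group K" and B: "B \<in> fixing_group K"
  show "A ** B \<in> fixing_group K"
    using A B by (simp add: fixing_group_def orthogonal_matrix_mul matrix_vector_mul_assoc[symmetric])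
next
  fix A assume A: "A \<in> fixing_group K"
  then show "orthogonal_matrix A" by (simp add: fixing_group_def)
  have oA: "orthogonal_matrix A" and Aa: "\<And>a. a \<in> first_factor K \<Longrightarrow> A *v a = a"
    using A by (auto simp: fixing_group_def)
  have "transpose A *v a = a" if "a \<in> first_factor K" for a
    using orthogonal_matrix_cancel(1)[OF oA, of a] unfolding Aa[OF that] .
  then show "transpose A \<in> fixing_group K"
    unfolding fixing_group_def using orthogonal_matrix_transpose[of A] oA by blast
next
  have "fixing_group K = {Q. transpose Q ** Q = mat 1} \<inter> (\<Inter>a\<in>first_factor K. {Q. Q *v a = a})"
    by (auto simp: fixing_group_def orthogonal_matrix)
  moreover have "closed \<dots>"
    by (intro closed_Int closed_INT ballI closed_Collect_eq continuous_intros)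
  ultimately show "closed (fixing_group K)" by simp
qed

lemma fixing_group_second_factor:
  assumes Q: "Q \<in> fixing_group K" and v: "v \<in> second_factor K" shows "Q *v v \<in> second_factor K"
  unfolding second_factor_iff
proof
  fix a assume a: "a \<in> first_factor K"
  have "a \<bullet> (Q *v v) = (transpose Q *v a) \<bullet> v"
    by (metis dot_lmul_matrix inner_commute vector_transpose_matrix transpose_transpose)
  also have "transpose Q *v a = a"
    using closed_orthogonal_groupD(4)[OF closed_orthogonal_group_fixing_group Q] a by (simp add: fixing_group_def)
  finally show "a \<bullet> (Q *v v) = 0" using first_second_orthogonal[OF a v] by simp
qed

section \<open>A recurrence principle\<close>

text \<open>The heart of the fact that a surjective nonexpanding self-map \<open>f\<close> of a compact metric space is
  injective. The sequences are backward orbits, \<open>f (x (Suc i)) = x i\<close>. Compactness brings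
  \<open>(x (i + m), y (i + m))\<close> close to \<open>(x i, y i)\<close> for some \<open>m > 0\<close>; applying \<open>f\<close> to the power \<open>i\<close>
  brings \<open>(x m, y m)\<close> close to \<open>(x 0, y 0)\<close>. As \<open>f\<close> to the power \<open>m - 1\<close> maps \<open>(x m, y m)\<close> to
  \<open>(x 1, y 1)\<close>, the distance of the latter two points is at most that of \<open>x 0\<close> and \<open>y 0\<close>, up to
  an arbitrarily small error.\<close>
lemma recurrent_pair:
  fixes x y :: "nat \<Rightarrow> 'a::metric_space" and d :: "'a \<Rightarrow> 'a \<Rightarrow> real"
  assumes compact: "compact S" and S: "\<And>i. x i \<in> S" "\<And>i. y i \<in> S"
    and d: "\<And>a b. a \<in> S \<Longrightarrow> b \<in> S \<Longrightarrow> d a b \<le> dist a b" "\<And>a b. a \<in> S \<Longrightarrow> b \<in> S \<Longrightarrow> d a b = d b a"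
      "\<And>a b c. a \<in> S \<Longrightarrow> b \<in> S \<Longrightarrow> c \<in> S \<Longrightarrow> d a c \<le> d a b + d b c"
    and mono: "\<And>i j. d (x i) (x j) \<le> d (x (Suc i)) (x (Suc j))" "\<And>i j. d (y i) (y j) \<le> d (y (Suc i)) (y (Suc j))"
      "\<And>i. d (x i) (y i) \<le> d (x (Suc i)) (y (Suc i))"
  shows "d (x 1) (y 1) \<le> d (x 0) (y 0)"
proof (rule field_le_epsilon)
  fix e :: real assume e: "0 < e"
  have xshift: "d (x 0) (x m) \<le> d (x i) (x (i + m))" for i m
    by (induction i) (auto intro: order_trans[OF _ mono(1)])
  have yshift: "d (y 0) (y m) \<le> d (y i) (y (i + m))" for i m
    by (induction i) (auto intro: order_trans[OF _ mono(2)])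
  have xy: "d (x 1) (y 1) \<le> d (x (Suc m)) (y (Suc m))" for m
    by (induction m) (auto intro: order_trans[OF _ mono(3)])
  have "(x i, y i) \<in> S \<times> S" for i using S by simp
  then obtain l r where r: "strict_mono r" "(\<lambda>i. (x (r i), y (r i))) \<longlonglongrightarrow> l"
    by (rule compact_subsequence[OF compact_Times[OF compact compact]])
  from r(2) have "Cauchy (\<lambda>i. (x (r i), y (r i)))" by (intro convergent_Cauchy convergentI)
  then obtain M where M: "\<And>i j. i \<ge> M \<Longrightarrow> j \<ge> M \<Longrightarrow> dist (x (r i), y (r i)) (x (r j), y (r j)) < e / 2"
    unfolding Cauchy_def using e half_gt_zero by metis
  define i m where "i = r M" and "m = r (Suc M) - r M"
  have m: "0 < m" "r (Suc M) = i + m" using strict_monoD[OF r(1), of M "Suc M"] by (auto simp: i_def m_def)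
  have close: "dist (x i, y i) (x (i + m), y (i + m)) < e / 2"
    using M[of M "Suc M"] m(2) by (simp add: i_def)
  have "dist (x i) (x (i + m)) < e / 2" "dist (y i) (y (i + m)) < e / 2"
    using dist_fst_le[of "(x i, y i)" "(x (i + m), y (i + m))"] dist_snd_le[of "(x i, y i)" "(x (i + m), y (i + m))"] close by auto
  then have "d (x 0) (x m) < e / 2" "d (y 0) (y m) < e / 2"
    using xshift[of m i] yshift[of m i] d(1)[OF S(1) S(1), of i "i + m"] d(1)[OF S(2) S(2), of i "i + m"] by linarith+
  moreover have "d (x 1) (y 1) \<le> d (x m) (y m)" using xy[of "m - 1"] m(1) by simp
  moreover have "d (x m) (y m) \<le> d (x 0) (x m) + d (x 0) (y 0) + d (y 0) (y m)"
    using d(3)[OF S(1)[of m] S(1)[of 0] S(2)[of m]] d(3)[OF S(1)[of 0] S(2)[of 0] S(2)[of m]]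
      d(2)[OF S(1)[of m] S(1)[of 0]] by linarith
  ultimately show "d (x 1) (y 1) \<le> d (x 0) (y 0) + e" by linarith
qed

section \<open>Equidistant leaves with homogeneous layers\<close>

definition leaf :: "'a set set \<Rightarrow> 'a \<Rightarrow> 'a set" where
  "leaf \<F> x = (THE L. L \<in> \<F> \<and> x \<in> L)"

lemma leaf_unique:
  assumes "partition_on UNIV \<F>" "L \<in> \<F>" "x \<in> L" shows "leaf \<F> x = L"
  unfolding leaf_def
  by (rule the_equality) (use assms in \<open>auto simp: partition_on_def disjoint_def\<close>)

lemma leaf_mem:
  assumes "partition_on UNIV \<F>" shows "leaf \<F> x \<in> \<F>" "x \<in> leaf \<F> x"
proof -
  have "x \<in> \<Union>\<F>" using assms by (simp add: partition_on_def)
  then obtain L where "L \<in> \<F>" "x \<in> L" by blast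
  then show "leaf \<F> x \<in> \<F>" "x \<in> leaf \<F> x" using leaf_unique[OF assms] by auto
qed

text \<open>The largest group of orthogonal maps of the layer at \<open>p\<close> that preserve the slice of every leaf.
  It contains every group whose orbits are the slices, and unlike such a group it is determined by the
  foliation; its semicontinuity in \<open>p\<close> depends on this choice.\<close>
definition layer_group :: "(real^'m) set set \<Rightarrow> 'm::finite set \<Rightarrow> real^'m \<Rightarrow> (real^'m^'m) set" where
  "layer_group \<F> K p = {Q \<in> fixing_group K. \<forall>v\<in>second_factor K. leaf \<F> (p + Q *v v) = leaf \<F> (p + v)}"

text \<open>The consequences of equidistance and homogeneity on which the argument rests.\<close>
locale homogeneous_layers =
  fixes \<F> :: "(real^'m) set set" and K :: "'m::finite set"
  assumes leaves_partition: "partition_on UNIV \<F>"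
    and leaves_closed: "L \<in> \<F> \<Longrightarrow> closed L"
    and equidistant: "L \<in> \<F> \<Longrightarrow> M \<in> \<F> \<Longrightarrow> x \<in> L \<Longrightarrow> y \<in> L \<Longrightarrow> infdist x M = infdist y M"
    and affine_leaf: "first_factor K \<in> \<F>"
    and leaf_meets_layer: "p \<in> first_factor K \<Longrightarrow> L \<in> \<F> \<Longrightarrow> \<exists>v\<in>second_factor K. p + v \<in> L"
    and layer_transitive: "p \<in> first_factor K \<Longrightarrow> v \<in> second_factor K \<Longrightarrow> w \<in> second_factor K \<Longrightarrow>
        leaf \<F> (p + v) = leaf \<F> (p + w) \<Longrightarrow> \<exists>Q\<in>layer_group \<F> K p. w = Q *v v"
begin

abbreviation "E \<equiv> first_factor K"
abbreviation "N \<equiv> second_factor K"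
abbreviation "lf \<equiv> leaf \<F>"

lemmas leaf_eqI = leaf_unique[OF leaves_partition]
  and leaf_in = leaf_mem(1)[OF leaves_partition]
  and leaf_self = leaf_mem(2)[OF leaves_partition]

lemma leaf_eq_iff: "lf x = lf y \<longleftrightarrow> x \<in> lf y"
  using leaf_eqI[OF leaf_in] leaf_self by metis

lemma leaf_nonempty: "L \<in> \<F> \<Longrightarrow> L \<noteq> {}"
  using leaves_partition by (auto simp: partition_on_def)

lemma infdist_leaf_eq: "lf x = lf y \<Longrightarrow> M \<in> \<F> \<Longrightarrow> infdist x M = infdist y M"
  using equidistant[OF leaf_in] leaf_self by metis

lemma nearest_in_leaf:
  assumes "M \<in> \<F>" obtains y where "y \<in> M" "lf y = M" "infdist x M = dist x y"
  using infdist_attains_inf[OF leaves_closed[OF assms] leaf_nonempty[OF assms]] leaf_eqI[OF assms] by metis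

lemma leaf_radius:
  assumes "p \<in> E" "q \<in> E" "v \<in> N" "w \<in> N" "lf (p + v) = lf (q + w)" shows "norm v = norm w"
  using infdist_leaf_eq[OF assms(5) affine_leaf] infdist_first_factor assms by metis

text \<open>The points \<open>q + v\<close> and \<open>q + t *\<^sub>R v\<close> lie on a common ray from \<open>E\<close>, so the distance between their leaves
  is the difference of their distances to \<open>E\<close>. By equidistance \<open>p + w\<close> also has a point \<open>y\<close> of the second
  leaf at this distance, and equality in the triangle inequality puts \<open>y\<close> on the ray from \<open>p\<close>
  through \<open>p + w\<close>.\<close>
lemma homothety:
  assumes p: "p \<in> E" and q: "q \<in> E" and v: "v \<in> N" and w: "w \<in> N"
    and eq: "lf (q + v) = lf (p + w)" and t: "0 \<le> t"
  shows "lf (q + t *\<^sub>R v) = lf (p + t *\<^sub>R w)"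
proof -
  let ?M = "lf (q + t *\<^sub>R v)"
  have tv: "t *\<^sub>R v \<in> N" by (rule subspace_scale[OF subspace_second_factor v])
  have vw: "norm v = norm w" by (rule leaf_radius[OF q p v w eq])
  obtain y where y: "lf y = ?M" "infdist (p + w) ?M = dist (p + w) y"
    using nearest_in_leaf[OF leaf_in] by metis
  obtain a b where ab: "a \<in> E" "b \<in> N" "y = a + b" using factor_decomposition by metis
  have b: "norm b = t * norm w"
    using leaf_radius[OF ab(1) q ab(2) tv] y(1) ab(3) vw t by simp
  have "infdist (p + w) ?M = infdist (q + v) ?M" by (rule infdist_leaf_eq[OF eq[symmetric] leaf_in])
  also have "\<dots> \<le> dist (q + v) (q + t *\<^sub>R v)" by (rule infdist_le[OF leaf_self])
  also have "\<dots> = norm ((1 - t) *\<^sub>R v)" by (simp add: dist_norm algebra_simps)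
  also have "\<dots> = \<bar>1 - t\<bar> * norm w" by (simp add: vw)
  finally have "norm ((p - a) + (w - b)) \<le> \<bar>1 - t\<bar> * norm w"
    unfolding y(2) dist_norm ab(3) by (simp add: algebra_simps)
  then have "(norm ((p - a) + (w - b)))\<^sup>2 \<le> (\<bar>1 - t\<bar> * norm w)\<^sup>2" by (rule power_mono) simp
  then have "(norm (p - a))\<^sup>2 + (norm (w - b))\<^sup>2 \<le> (1 - t)\<^sup>2 * (norm w)\<^sup>2"
    unfolding norm_factor_sum[OF subspace_diff[OF subspace_first_factor p ab(1)]
        subspace_diff[OF subspace_second_factor w ab(2)]]
    by (simp add: power_mult_distrib)
  moreover have "(norm (w - b))\<^sup>2 = (norm w)\<^sup>2 + (norm b)\<^sup>2 - 2 * (w \<bullet> b)"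
    by (simp add: power2_norm_eq_inner inner_diff inner_commute)
  moreover have "(norm (b - t *\<^sub>R w))\<^sup>2 = (norm b)\<^sup>2 + t\<^sup>2 * (norm w)\<^sup>2 - 2 * t * (w \<bullet> b)"
    unfolding power2_norm_eq_inner power2_eq_square[of t] by (simp add: inner_diff inner_commute algebra_simps)
  moreover have "(norm b)\<^sup>2 = t\<^sup>2 * (norm w)\<^sup>2" by (simp add: b power_mult_distrib)
  moreover have cs: "w \<bullet> b \<le> t * (norm w)\<^sup>2"
    using norm_cauchy_schwarz[of w b] by (simp add: b power2_eq_square mult_ac)
  moreover have "(1 - t)\<^sup>2 * (norm w)\<^sup>2 = (norm w)\<^sup>2 + t\<^sup>2 * (norm w)\<^sup>2 - 2 * (t * (norm w)\<^sup>2)"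
    by (simp add: power2_eq_square algebra_simps)
  ultimately have pa: "(norm (p - a))\<^sup>2 \<le> 0" and wb: "w \<bullet> b = t * (norm w)\<^sup>2"
    using zero_le_power2[of "norm (p - a)"] by linarith+
  have "(norm (b - t *\<^sub>R w))\<^sup>2 = 0"
    using \<open>(norm (b - t *\<^sub>R w))\<^sup>2 = (norm b)\<^sup>2 + t\<^sup>2 * (norm w)\<^sup>2 - 2 * t * (w \<bullet> b)\<close>
      \<open>(norm b)\<^sup>2 = t\<^sup>2 * (norm w)\<^sup>2\<close> wb by (simp add: power2_eq_square)
  then have "y = p + t *\<^sub>R w" using pa ab(3) by simp
  then show ?thesis using y(1) by simp
qed

lemma homothety_inverse:
  assumes p: "p \<in> E" and q: "q \<in> E" and v: "v \<in> N" and w: "w \<in> N"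
    and eq: "lf (q + t *\<^sub>R v) = lf (p + t *\<^sub>R w)" and t: "0 < t"
  shows "lf (q + v) = lf (p + w)"
  using homothety[OF p q subspace_scale[OF subspace_second_factor v] subspace_scale[OF subspace_second_factor w] eq, of "inverse t"] t
  by simp

text \<open>The distance between two slices of the same layer cannot exceed that of the corresponding slices of
  another layer. Shrink everything by \<open>s n\<close>: the leaves of \<open>p + s n *\<^sub>R v'\<close> and \<open>q + s n *\<^sub>R w\<close> are at most
  \<open>s n * norm (v - w)\<close> apart, so some point \<open>a + s n *\<^sub>R u\<close> of the latter is that close to the former
  point. Enlarging by \<open>1 / s n\<close> along the rays from \<open>E\<close> multiplies the second component
  by \<open>1 / s n\<close> and leaves \<open>a\<close> alone, and \<open>a\<close> tends to \<open>p\<close>.\<close>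
lemma layer_distance_transfer:
  assumes p: "p \<in> E" and q: "q \<in> E" and v: "v \<in> N" and w: "w \<in> N" and v': "v' \<in> N"
    and eq: "lf (q + v) = lf (p + v')"
  shows "\<exists>w'\<in>N. lf (p + w') = lf (q + w) \<and> norm (v' - w') \<le> norm (v - w)"
proof -
  define s where "s n = inverse (real (Suc n))" for n
  have s: "0 < s n" for n by (simp add: s_def)
  let ?r = "norm (v - w)"
  have "\<exists>a u. a \<in> E \<and> u \<in> N \<and> lf (a + u) = lf (q + w) \<and> norm (p - a) \<le> s n * ?r \<and> norm (v' - u) \<le> ?r" for n
  proof -
    let ?M = "lf (q + s n *\<^sub>R w)"
    have t: "0 \<le> s n" using s[of n] by simp
    obtain y where y: "lf y = ?M" "infdist (p + s n *\<^sub>R v') ?M = dist (p + s n *\<^sub>R v') y"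
      using nearest_in_leaf[OF leaf_in] by metis
    obtain a b where ab: "a \<in> E" "b \<in> N" "y = a + b" using factor_decomposition by metis
    define u where "u = inverse (s n) *\<^sub>R b"
    have b: "b = s n *\<^sub>R u" using s[of n] by (simp add: u_def)
    have u: "u \<in> N" unfolding u_def by (rule subspace_scale[OF subspace_second_factor ab(2)])
    have au: "lf (a + u) = lf (q + w)"
      by (rule homothety_inverse[OF q ab(1) u w _ s[of n]]) (use y(1) ab(3) b in simp)
    have "infdist (p + s n *\<^sub>R v') ?M = infdist (q + s n *\<^sub>R v) ?M"
      by (rule infdist_leaf_eq[OF homothety[OF p q v v' eq t, symmetric] leaf_in])
    also have "\<dots> \<le> dist (q + s n *\<^sub>R v) (q + s n *\<^sub>R w)" by (rule infdist_le[OF leaf_self])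
    also have "\<dots> = norm (s n *\<^sub>R (v - w))" by (simp add: dist_norm scaleR_diff_right)
    also have "\<dots> = s n * ?r" using t by simp
    finally have "norm ((p - a) + s n *\<^sub>R (v' - u)) \<le> s n * ?r"
      unfolding y(2) dist_norm ab(3) b by (simp add: algebra_simps)
    then have "(norm ((p - a) + s n *\<^sub>R (v' - u)))\<^sup>2 \<le> (s n * ?r)\<^sup>2" by (rule power_mono) simp
    then have le: "(norm (p - a))\<^sup>2 + (norm (s n *\<^sub>R (v' - u)))\<^sup>2 \<le> (s n * ?r)\<^sup>2"
      unfolding norm_factor_sum[OF subspace_diff[OF subspace_first_factor p ab(1)]
          subspace_scale[OF subspace_second_factor subspace_diff[OF subspace_second_factor v' u]]] .
    have nn: "0 \<le> s n * ?r" using t by simp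
    have 1: "norm (p - a) \<le> s n * ?r"
      by (rule power2_le_imp_le[OF _ nn]) (use le zero_le_power2[of "norm (s n *\<^sub>R (v' - u))"] in linarith)
    have "norm (s n *\<^sub>R (v' - u)) \<le> s n * ?r"
      by (rule power2_le_imp_le[OF _ nn]) (use le zero_le_power2[of "norm (p - a)"] in linarith)
    then have 2: "norm (v' - u) \<le> ?r" using s[of n] by simp
    show ?thesis using ab(1) u au 1 2 by blast
  qed
  then obtain a u where au: "\<And>n. a n \<in> E" "\<And>n. u n \<in> N" "\<And>n. lf (a n + u n) = lf (q + w)"
    "\<And>n. norm (p - a n) \<le> s n * ?r" "\<And>n. norm (v' - u n) \<le> ?r"
    by metis
  have inC: "u n \<in> N \<inter> cball v' ?r" for n using au(2,5)[of n] by (simp add: dist_norm)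
  have "compact (N \<inter> cball v' ?r)"
    by (intro closed_Int_compact compact_cball closed_subspace subspace_second_factor)
  then obtain w' r where w': "w' \<in> N \<inter> cball v' ?r" "strict_mono r" "(\<lambda>n. u (r n)) \<longlonglongrightarrow> w'"
    using inC by (rule compact_subsequence)
  have "(\<lambda>n. s n * ?r) \<longlonglongrightarrow> 0 * ?r"
    unfolding s_def by (intro tendsto_intros LIMSEQ_inverse_real_of_nat)
  then have s0: "(\<lambda>n. s n * ?r) \<longlonglongrightarrow> 0" by simp
  have "(\<lambda>n. p - a n) \<longlonglongrightarrow> 0"
    by (rule Lim_null_comparison[OF eventuallyI s0]) (rule au(4))
  then have "a \<longlonglongrightarrow> p" using tendsto_diff[OF tendsto_const[of p], of "\<lambda>n. p - a n" 0] by simp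
  then have "(\<lambda>n. a (r n)) \<longlonglongrightarrow> p" using LIMSEQ_subseq_LIMSEQ[OF _ w'(2)] by (simp add: o_def)
  then have "(\<lambda>n. a (r n) + u (r n)) \<longlonglongrightarrow> p + w'" by (intro tendsto_add w'(3))
  moreover have "a (r n) + u (r n) \<in> lf (q + w)" for n using au(3)[of "r n"] leaf_eq_iff by blast
  ultimately have "p + w' \<in> lf (q + w)"
    by (rule closed_sequentially[OF leaves_closed[OF leaf_in], rotated -1])
  then have "lf (p + w') = lf (q + w)" using leaf_eq_iff by blast
  then show ?thesis using w'(1) by (auto simp: dist_norm)
qed

lemma closed_orthogonal_group_layer_group:
  assumes p: "p \<in> E" shows "closed_orthogonal_group (layer_group \<F> K p)"
proof -
  note \<Gamma> = closed_orthogonal_groupD[OF closed_orthogonal_group_fixing_group[of K]]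
  have 1: "mat 1 \<in> layer_group \<F> K p" by (simp add: layer_group_def \<Gamma>(2))
  have 2: "A ** B \<in> layer_group \<F> K p" if A: "A \<in> layer_group \<F> K p" and B: "B \<in> layer_group \<F> K p" for A B
  proof -
    have AB: "A \<in> fixing_group K" "B \<in> fixing_group K" using A B by (auto simp: layer_group_def)
    have "lf (p + (A ** B) *v v) = lf (p + v)" if v: "v \<in> N" for v
    proof -
      have "lf (p + A *v (B *v v)) = lf (p + B *v v)"
        using A fixing_group_second_factor[OF AB(2) v] by (simp add: layer_group_def)
      also have "\<dots> = lf (p + v)" using B v by (simp add: layer_group_def)
      finally show ?thesis by (simp add: matrix_vector_mul_assoc)
    qed
    then show ?thesis using \<Gamma>(3)[OF AB] by (simp add: layer_group_def)
  qed
  have 3: "transpose A \<in> layer_group \<F> K p" if A: "A \<in> layer_group \<F> K p" for A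
  proof -
    have A': "A \<in> fixing_group K" using A by (simp add: layer_group_def)
    note tA = \<Gamma>(4)[OF A']
    have "lf (p + transpose A *v v) = lf (p + v)" if v: "v \<in> N" for v
    proof -
      have "lf (p + A *v (transpose A *v v)) = lf (p + transpose A *v v)"
        using A fixing_group_second_factor[OF tA v] unfolding layer_group_def by blast
      then show ?thesis unfolding orthogonal_matrix_cancel(2)[OF \<Gamma>(1)[OF A']] by simp
    qed
    then show ?thesis using tA unfolding layer_group_def by blast
  qed
  have "layer_group \<F> K p = fixing_group K \<inter> (\<Inter>v\<in>N. {Q. p + Q *v v \<in> lf (p + v)})"
    unfolding layer_group_def using leaf_eq_iff by auto
  moreover have "closed \<dots>"
  proof (intro closed_Int \<Gamma>(5) closed_INT ballI)
    fix v
    have "closed ((\<lambda>Q. p + Q *v v) -` lf (p + v))"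
      by (intro closed_vimage leaves_closed leaf_in continuous_intros)
    then show "closed {Q. p + Q *v v \<in> lf (p + v)}" by (simp add: vimage_def)
  qed
  ultimately have 4: "closed (layer_group \<F> K p)" by simp
  have "\<forall>A\<in>layer_group \<F> K p. orthogonal_matrix A" by (auto simp: layer_group_def \<Gamma>(1))
  then show ?thesis unfolding closed_orthogonal_group_def using 1 2 3 4 by blast
qed

text \<open>It suffices that limits of elements of the groups at \<open>q n\<close> belong to the group at \<open>p\<close>. If \<open>A\<close> is
  the limit of \<open>Q n\<close>, then \<open>q n + Q n *v v\<close> and \<open>q n + v\<close> share a leaf and are equally far from the leaf of
  \<open>p + v\<close>; in the limit this distance is \<open>0\<close>.\<close>
lemma layer_group_upper_semicontinuous:
  assumes p: "p \<in> E" and e: "0 < e"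
  shows "\<exists>\<delta>>0. \<forall>q\<in>E. dist p q < \<delta> \<longrightarrow>
     (\<forall>Q\<in>layer_group \<F> K q. \<exists>g\<in>layer_group \<F> K p. norm (Q - g) \<le> e)"
proof (rule ccontr)
  assume con: "\<not> ?thesis"
  have "\<exists>q Q. q \<in> E \<and> dist p q < inverse (real (Suc n)) \<and> Q \<in> layer_group \<F> K q \<and>
     (\<forall>g\<in>layer_group \<F> K p. e < norm (Q - g))" for n
  proof -
    have "0 < inverse (real (Suc n))" by simp
    then show ?thesis using con by (meson not_le)
  qed
  then obtain q Q where qQ: "\<And>n. q n \<in> E" "\<And>n. dist p (q n) < inverse (real (Suc n))"
    "\<And>n. Q n \<in> layer_group \<F> K (q n)" "\<And>n g. g \<in> layer_group \<F> K p \<Longrightarrow> e < norm (Q n - g)"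
    by metis
  have Q\<Gamma>: "Q n \<in> fixing_group K" for n using qQ(3)[of n] by (simp add: layer_group_def)
  obtain A r where A: "A \<in> fixing_group K" "strict_mono r" "(\<lambda>n. Q (r n)) \<longlonglongrightarrow> A"
    by (rule compact_subsequence[OF closed_orthogonal_group_compact[OF closed_orthogonal_group_fixing_group] Q\<Gamma>])
  have "(\<lambda>n. dist (q n) p) \<longlonglongrightarrow> 0"
    by (rule Lim_null_comparison[OF eventuallyI LIMSEQ_inverse_real_of_nat])
      (use qQ(2) in \<open>simp add: dist_commute less_imp_le\<close>)
  then have "q \<longlonglongrightarrow> p" by (rule iffD2[OF tendsto_dist_iff])
  then have q: "(\<lambda>n. q (r n)) \<longlonglongrightarrow> p" using LIMSEQ_subseq_LIMSEQ[OF _ A(2)] by (simp add: o_def)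
  have "lf (p + A *v v) = lf (p + v)" if v: "v \<in> N" for v
  proof -
    let ?F = "lf (p + v)"
    have "infdist (q (r n) + Q (r n) *v v) ?F = infdist (q (r n) + v) ?F" for n
      by (rule infdist_leaf_eq[OF _ leaf_in]) (use qQ(3)[of "r n"] v in \<open>simp add: layer_group_def\<close>)
    moreover have "(\<lambda>n. infdist (q (r n) + Q (r n) *v v) ?F) \<longlonglongrightarrow> infdist (p + A *v v) ?F"
      by (intro tendsto_intros q A(3))
    moreover have "(\<lambda>n. infdist (q (r n) + v) ?F) \<longlonglongrightarrow> infdist (p + v) ?F"
      by (intro tendsto_intros q)
    ultimately have "infdist (p + A *v v) ?F = infdist (p + v) ?F" using LIMSEQ_unique by fastforce
    also have "\<dots> = 0" using leaf_self by simp
    finally have "p + A *v v \<in> ?F"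
      using in_closed_iff_infdist_zero[OF leaves_closed[OF leaf_in] leaf_nonempty[OF leaf_in]] by blast
    then show ?thesis using leaf_eq_iff by blast
  qed
  then have "A \<in> layer_group \<F> K p" using A(1) by (simp add: layer_group_def)
  then have "e < norm (Q (r n) - A)" for n by (rule qQ(4))
  moreover have "\<exists>n. dist (Q (r n)) A < e"
    using eventually_happens'[OF sequentially_bot tendstoD[OF A(3) e]] .
  ultimately show False by (metis dist_norm less_asym)
qed

text \<open>The distance in the orbit space of the layer at \<open>p\<close>, as a pseudometric on the second factor.\<close>
definition layer_dist :: "real^'m \<Rightarrow> real^'m \<Rightarrow> real^'m \<Rightarrow> real" where
  "layer_dist p u w = infdist u ((\<lambda>Q. Q *v w) ` layer_group \<F> K p)"

lemma layer_group_sub: "layer_group \<F> K p \<subseteq> fixing_group K"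
  by (auto simp: layer_group_def)

lemma layer_group_leaf: "Q \<in> layer_group \<F> K p \<Longrightarrow> v \<in> N \<Longrightarrow> lf (p + Q *v v) = lf (p + v)"
  by (simp add: layer_group_def)

lemma layer_group_second_factor: "Q \<in> layer_group \<F> K p \<Longrightarrow> v \<in> N \<Longrightarrow> Q *v v \<in> N"
  using fixing_group_second_factor layer_group_sub by blast

lemma layer_dist_le_orbit: "Q \<in> layer_group \<F> K p \<Longrightarrow> layer_dist p u w \<le> norm (u - Q *v w)"
  unfolding layer_dist_def dist_norm[symmetric] by (rule infdist_le) simp

lemma layer_dist_attained:
  assumes p: "p \<in> E" shows "\<exists>Q\<in>layer_group \<F> K p. layer_dist p u w = norm (u - Q *v w)"
proof -
  note G = closed_orthogonal_group_layer_group[OF p]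
  let ?O = "(\<lambda>Q. Q *v w) ` layer_group \<F> K p"
  have "compact ?O"
    by (intro compact_continuous_image closed_orthogonal_group_compact[OF G] continuous_intros)
  then have "closed ?O" by (rule compact_imp_closed)
  moreover have "?O \<noteq> {}" using closed_orthogonal_groupD(2)[OF G] by blast
  ultimately obtain z where "z \<in> ?O" "infdist u ?O = dist u z" by (rule infdist_attains_inf)
  then show ?thesis unfolding layer_dist_def by (auto simp: dist_norm)
qed

lemma layer_dist_le:
  assumes "p \<in> E" "w \<in> N" "z \<in> N" "lf (p + z) = lf (p + w)"
  shows "layer_dist p u w \<le> norm (u - z)"
  using layer_transitive[OF assms(1-3) assms(4)[symmetric]] layer_dist_le_orbit by blast

lemma layer_dist_commute_le:
  assumes p: "p \<in> E" shows "layer_dist p u w \<le> layer_dist p w u"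
proof -
  note G = closed_orthogonal_group_layer_group[OF p]
  obtain Q where Q: "Q \<in> layer_group \<F> K p" "layer_dist p w u = norm (w - Q *v u)"
    using layer_dist_attained[OF p] by blast
  note tQ = closed_orthogonal_groupD(4)[OF G Q(1)]
  have "norm (u - transpose Q *v w) = norm (transpose Q *v (Q *v u) - transpose Q *v w)"
    unfolding orthogonal_matrix_cancel(1)[OF closed_orthogonal_groupD(1)[OF G Q(1)]] ..
  also have "\<dots> = norm (Q *v u - w)"
    by (rule orthogonal_matrix_cancel(4)[OF closed_orthogonal_groupD(1)[OF G tQ]])
  finally have "norm (u - transpose Q *v w) = layer_dist p w u"
    unfolding Q(2) by (simp only: norm_minus_commute)
  then show ?thesis using layer_dist_le_orbit[OF tQ, of u w] by linarith
qed

lemma layer_dist_commute: "p \<in> E \<Longrightarrow> layer_dist p u w = layer_dist p w u"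
  by (intro antisym layer_dist_commute_le)

lemma layer_dist_triangle:
  assumes p: "p \<in> E" shows "layer_dist p u w \<le> layer_dist p u z + layer_dist p z w"
proof -
  note G = closed_orthogonal_group_layer_group[OF p]
  obtain Q where Q: "Q \<in> layer_group \<F> K p" "layer_dist p u z = norm (u - Q *v z)"
    using layer_dist_attained[OF p] by blast
  obtain R where R: "R \<in> layer_group \<F> K p" "layer_dist p z w = norm (z - R *v w)"
    using layer_dist_attained[OF p] by blast
  have "layer_dist p u w \<le> norm (u - (Q ** R) *v w)"
    by (rule layer_dist_le_orbit[OF closed_orthogonal_groupD(3)[OF G Q(1) R(1)]])
  also have "u - (Q ** R) *v w = (u - Q *v z) + (Q *v z - Q *v (R *v w))"
    by (simp add: matrix_vector_mul_assoc)
  also have "norm \<dots> \<le> norm (u - Q *v z) + norm (Q *v z - Q *v (R *v w))" by (rule norm_triangle_ineq)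
  also have "norm (Q *v z - Q *v (R *v w)) = norm (z - R *v w)"
    by (rule orthogonal_matrix_cancel(4)[OF closed_orthogonal_groupD(1)[OF G Q(1)]])
  finally show ?thesis using Q(2) R(2) by simp
qed

lemma layer_dist_le_dist: "p \<in> E \<Longrightarrow> u \<in> N \<Longrightarrow> w \<in> N \<Longrightarrow> layer_dist p u w \<le> dist u w"
  using layer_dist_le[of p w w u] by (simp add: dist_norm)

lemma layer_dist_zero_imp_leaf_eq:
  assumes p: "p \<in> E" and w: "w \<in> N" and "layer_dist p u w \<le> 0"
  shows "lf (p + u) = lf (p + w)"
proof -
  obtain Q where Q: "Q \<in> layer_group \<F> K p" "layer_dist p u w = norm (u - Q *v w)"
    using layer_dist_attained[OF p] by blast
  then have "u = Q *v w" using assms(3) by simp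
  then show ?thesis using layer_group_leaf[OF Q(1) w] by simp
qed

text \<open>The classes of the relation are open by \<open>layers_locally_congruent\<close>, and \<open>E\<close> is connected.\<close>
definition layers_congruent :: "real^'m \<Rightarrow> real^'m \<Rightarrow> bool" where
  "layers_congruent p q \<longleftrightarrow> (\<exists>B\<in>fixing_group K. \<forall>v\<in>N. \<forall>w\<in>N.
     lf (p + v) = lf (p + w) \<longleftrightarrow> lf (q + B *v v) = lf (q + B *v w))"

text \<open>Sending the leaf of \<open>q + B *v u\<close> to the leaf of \<open>p + u\<close> is well defined by the inclusion of the
  conjugate group. This self-map of the space of leaves is surjective, preserves the distance to \<open>E\<close>, and does
  not increase \<open>layer_dist p\<close>, because both layers induce the same distances between leaves. On compact
  balls such a map is injective.\<close>
lemma subconjugate_imp_congruent: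
  assumes p: "p \<in> E" and q: "q \<in> E" and B: "B \<in> fixing_group K"
    and conj: "\<And>k. k \<in> layer_group \<F> K q \<Longrightarrow> transpose B ** k ** B \<in> layer_group \<F> K p"
  shows "layers_congruent p q"
proof -
  have oB: "orthogonal_matrix B" and tB: "transpose B \<in> fixing_group K"
    using closed_orthogonal_groupD[OF closed_orthogonal_group_fixing_group] B by blast+
  note BN = fixing_group_second_factor[OF B] and tBN = fixing_group_second_factor[OF tB]
  note cancel = orthogonal_matrix_cancel[OF oB]
  have fwd: "lf (p + v) = lf (p + w)" if v: "v \<in> N" and w: "w \<in> N" and eq: "lf (q + B *v v) = lf (q + B *v w)" for v w
  proof -
    obtain k where k: "k \<in> layer_group \<F> K q" "B *v w = k *v (B *v v)"
      using layer_transitive[OF q BN[OF v] BN[OF w] eq] by blast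
    have "w = transpose B *v (k *v (B *v v))" using cancel(1)[of w] unfolding k(2) by (rule sym)
    then have "w = (transpose B ** k ** B) *v v" by (simp only: matrix_vector_mul_assoc matrix_mul_assoc)
    then show ?thesis using layer_group_leaf[OF conj[OF k(1)] v] by simp
  qed
  have lift: "\<exists>u\<in>N. lf (p + u) = lf (q + B *v u')" for u'
  proof -
    obtain u where "u \<in> N" "p + u \<in> lf (q + B *v u')" using leaf_meets_layer[OF p leaf_in] by blast
    then show ?thesis using leaf_eq_iff by blast
  qed
  have nonexp: "layer_dist p u' w' \<le> layer_dist p u w"
    if uw: "u \<in> N" "w \<in> N" "u' \<in> N" "w' \<in> N" and uu: "lf (p + u) = lf (q + B *v u')" and ww: "lf (p + w) = lf (q + B *v w')"
    for u w u' w'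
  proof -
    obtain Q where Q: "Q \<in> layer_group \<F> K p" "layer_dist p u w = norm (u - Q *v w)"
      using layer_dist_attained[OF p] by blast
    obtain w'' where w'': "w'' \<in> N" "lf (q + w'') = lf (p + Q *v w)" "norm (B *v u' - w'') \<le> norm (u - Q *v w)"
      using layer_distance_transfer[OF q p uw(1) layer_group_second_factor[OF Q(1) uw(2)] BN[OF uw(3)] uu] by blast
    let ?t = "transpose B *v w''"
    have t: "?t \<in> N" by (rule tBN[OF w''(1)])
    have Bt: "B *v ?t = w''" by (rule cancel(2))
    have "lf (q + B *v ?t) = lf (q + B *v w')"
      unfolding Bt w''(2) layer_group_leaf[OF Q(1) uw(2)] ww ..
    then have "layer_dist p u' w' \<le> norm (u' - ?t)"
      by (intro layer_dist_le[OF p uw(4) t] fwd[OF t uw(4)])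
    also have "\<dots> = norm (B *v u' - w'')" using cancel(4)[of u' ?t] unfolding Bt by simp
    finally show ?thesis using w''(3) Q(2) by linarith
  qed
  have bwd: "lf (q + B *v v) = lf (q + B *v w)" if v: "v \<in> N" and w: "w \<in> N" and eq: "lf (p + v) = lf (p + w)" for v w
  proof -
    \<comment> \<open>Backward orbits of the self-map exist because every leaf meets the layer at \<open>p\<close>.\<close>
    have "\<exists>x. x 0 = v0 \<and> (\<forall>i. x i \<in> N \<and> lf (p + x (Suc i)) = lf (q + B *v x i))" if "v0 \<in> N" for v0
    proof -
      define s where "s u' = (SOME u. u \<in> N \<and> lf (p + u) = lf (q + B *v u'))" for u'
      have s: "s u' \<in> N \<and> lf (p + s u') = lf (q + B *v u')" for u'
        unfolding s_def by (rule someI_ex) (use lift in blast)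
      have "(s ^^ i) v0 \<in> N" for i by (cases i) (use that s in auto)
      then show ?thesis using s by (intro exI[of _ "\<lambda>i. (s ^^ i) v0"]) auto
    qed
    then obtain x y where x: "x 0 = v" "\<And>i. x i \<in> N" "\<And>i. lf (p + x (Suc i)) = lf (q + B *v x i)"
      and y: "y 0 = w" "\<And>i. y i \<in> N" "\<And>i. lf (p + y (Suc i)) = lf (q + B *v y i)"
      using v w by metis
    have nx: "norm (x i) = norm v" for i
    proof (induction i)
      case (Suc i)
      then show ?case using leaf_radius[OF p q x(2) BN[OF x(2)] x(3)] cancel(3) by simp
    qed (simp add: x)
    have ny: "norm (y i) = norm w" for i
    proof (induction i)
      case (Suc i)
      then show ?case using leaf_radius[OF p q y(2) BN[OF y(2)] y(3)] cancel(3) by simp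
    qed (simp add: y)
    let ?S = "N \<inter> cball 0 (max (norm v) (norm w))"
    have "layer_dist p (x 1) (y 1) \<le> layer_dist p (x 0) (y 0)"
    proof (rule recurrent_pair[where S = ?S])
      show "compact ?S" by (intro closed_Int_compact compact_cball closed_subspace subspace_second_factor)
      show "x i \<in> ?S" "y i \<in> ?S" for i using x(2) y(2) nx ny by auto
      show "layer_dist p a b \<le> dist a b" if "a \<in> ?S" "b \<in> ?S" for a b
        using layer_dist_le_dist[OF p] that by blast
      show "layer_dist p a b = layer_dist p b a" for a b by (rule layer_dist_commute[OF p])
      show "layer_dist p a c \<le> layer_dist p a b + layer_dist p b c" for a b c by (rule layer_dist_triangle[OF p])
    qed (intro nonexp x(2,3) y(2,3))+
    also have "\<dots> \<le> 0" using layer_dist_le[OF p w v eq, of v] x(1) y(1) by simp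
    finally have "lf (p + x 1) = lf (p + y 1)" by (rule layer_dist_zero_imp_leaf_eq[OF p y(2)])
    then show ?thesis using x(3)[of 0] y(3)[of 0] x(1) y(1) by simp
  qed
  show ?thesis unfolding layers_congruent_def using B fwd bwd by blast
qed

lemma layers_locally_congruent:
  assumes p: "p \<in> E"
  shows "\<exists>\<delta>>0. \<forall>q\<in>E. dist p q < \<delta> \<longrightarrow> layers_congruent p q"
proof -
  obtain e where e: "e > 0" and conj: "\<And>H. H \<subseteq> fixing_group K \<Longrightarrow> mat 1 \<in> H \<Longrightarrow> (\<forall>A\<in>H. \<forall>B\<in>H. A ** B \<in> H) \<Longrightarrow>
     (\<forall>A\<in>H. transpose A \<in> H) \<Longrightarrow> (\<forall>k\<in>H. \<exists>g\<in>layer_group \<F> K p. norm (k - g) \<le> e) \<Longrightarrow>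
     (\<exists>B\<in>fixing_group K. \<forall>k\<in>H. transpose B ** k ** B \<in> layer_group \<F> K p)"
    using near_subgroup_conjugate[OF closed_orthogonal_group_layer_group[OF p] closed_orthogonal_group_fixing_group layer_group_sub]
    by metis
  obtain \<delta> where \<delta>: "\<delta> > 0" "\<And>q. q \<in> E \<Longrightarrow> dist p q < \<delta> \<Longrightarrow>
     \<forall>Q\<in>layer_group \<F> K q. \<exists>g\<in>layer_group \<F> K p. norm (Q - g) \<le> e"
    using layer_group_upper_semicontinuous[OF p e] by blast
  have "layers_congruent p q" if q: "q \<in> E" "dist p q < \<delta>" for q
  proof -
    note G = closed_orthogonal_group_layer_group[OF q(1), unfolded closed_orthogonal_group_def]
    have "\<exists>B\<in>fixing_group K. \<forall>k\<in>layer_group \<F> K q. transpose B ** k ** B \<in> layer_group \<F> K p"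
      by (rule conj[OF layer_group_sub _ _ _ \<delta>(2)[OF q]]) (use G in blast)+
    then show ?thesis using subconjugate_imp_congruent[OF p q(1)] by blast
  qed
  then show ?thesis using \<delta>(1) by blast
qed

lemma layers_congruent_sym:
  assumes "layers_congruent p q" shows "layers_congruent q p"
proof -
  obtain B where B: "B \<in> fixing_group K"
    "\<And>v w. v \<in> N \<Longrightarrow> w \<in> N \<Longrightarrow> lf (p + v) = lf (p + w) \<longleftrightarrow> lf (q + B *v v) = lf (q + B *v w)"
    using assms unfolding layers_congruent_def by blast
  have oB: "orthogonal_matrix B" and tB: "transpose B \<in> fixing_group K"
    using closed_orthogonal_groupD[OF closed_orthogonal_group_fixing_group] B(1) by blast+
  have "lf (q + v) = lf (q + w) \<longleftrightarrow> lf (p + transpose B *v v) = lf (p + transpose B *v w)"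
    if "v \<in> N" "w \<in> N" for v w
    using B(2)[OF fixing_group_second_factor[OF tB that(1)] fixing_group_second_factor[OF tB that(2)]]
    unfolding orthogonal_matrix_cancel(2)[OF oB] by (rule sym)
  then show ?thesis unfolding layers_congruent_def using tB by blast
qed

lemma layers_congruent_trans:
  assumes "layers_congruent p q" "layers_congruent q r" shows "layers_congruent p r"
proof -
  obtain B where B: "B \<in> fixing_group K"
    "\<And>v w. v \<in> N \<Longrightarrow> w \<in> N \<Longrightarrow> lf (p + v) = lf (p + w) \<longleftrightarrow> lf (q + B *v v) = lf (q + B *v w)"
    using assms(1) unfolding layers_congruent_def by blast
  obtain C where C: "C \<in> fixing_group K"
    "\<And>v w. v \<in> N \<Longrightarrow> w \<in> N \<Longrightarrow> lf (q + v) = lf (q + w) \<longleftrightarrow> lf (r + C *v v) = lf (r + C *v w)"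
    using assms(2) unfolding layers_congruent_def by blast
  have "lf (p + v) = lf (p + w) \<longleftrightarrow> lf (r + (C ** B) *v v) = lf (r + (C ** B) *v w)"
    if "v \<in> N" "w \<in> N" for v w
    using B(2)[OF that] C(2)[OF fixing_group_second_factor[OF B(1) that(1)] fixing_group_second_factor[OF B(1) that(2)]]
    by (simp add: matrix_vector_mul_assoc)
  moreover have "C ** B \<in> fixing_group K"
    by (rule closed_orthogonal_groupD(3)[OF closed_orthogonal_group_fixing_group C(1) B(1)])
  ultimately show ?thesis unfolding layers_congruent_def by blast
qed

lemma layers_congruent:
  assumes "p \<in> E" "q \<in> E" shows "layers_congruent p q"
proof (rule connected_equivalence_relation[of E])
  show "connected E" by (intro convex_connected subspace_imp_convex subspace_first_factor)
  show "\<exists>T. openin (top_of_set E) T \<and> a \<in> T \<and> (\<forall>x\<in>T. layers_congruent a x)" if a: "a \<in> E" for a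
  proof -
    obtain \<delta> where "\<delta> > 0" "\<forall>q\<in>E. dist a q < \<delta> \<longrightarrow> layers_congruent a q"
      using layers_locally_congruent[OF a] by blast
    then show ?thesis using a
      by (intro exI[of _ "E \<inter> ball a \<delta>"]) (auto intro: openin_open_Int)
  qed
qed (use assms layers_congruent_sym layers_congruent_trans in blast)+

lemma isometric_layers:
  assumes p: "p \<in> E" and q: "q \<in> E"
  shows "isometric_foliations
      (horizontal_layer K p) (induced_foliation \<F> (horizontal_layer K p))
      (horizontal_layer K q) (induced_foliation \<F> (horizontal_layer K q))"
proof -
  obtain B where B: "B \<in> fixing_group K"
    "\<And>v w. v \<in> N \<Longrightarrow> w \<in> N \<Longrightarrow> lf (p + v) = lf (p + w) \<longleftrightarrow> lf (q + B *v v) = lf (q + B *v w)"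
    using layers_congruent[OF p q] unfolding layers_congruent_def by blast
  have oB: "orthogonal_matrix B" and tB: "transpose B \<in> fixing_group K"
    using closed_orthogonal_groupD[OF closed_orthogonal_group_fixing_group] B(1) by blast+
  note BN = fixing_group_second_factor[OF B(1)] and tBN = fixing_group_second_factor[OF tB]
  note cancel = orthogonal_matrix_cancel[OF oB]
  define f where "f x = q + B *v (x - p)" for x
  have f: "f (p + v) = q + B *v v" for v by (simp add: f_def)
  have slice: "f ` (lf (p + v) \<inter> horizontal_layer K p) = lf (q + B *v v) \<inter> horizontal_layer K q" if v: "v \<in> N" for v
  proof
    show "f ` (lf (p + v) \<inter> horizontal_layer K p) \<subseteq> lf (q + B *v v) \<inter> horizontal_layer K q"
    proof (rule image_subsetI)
      fix x assume x: "x \<in> lf (p + v) \<inter> horizontal_layer K p"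
      then obtain w where w: "x = p + w" "w \<in> N" by (auto simp: horizontal_layer_def)
      have "lf (p + w) = lf (p + v)" using x leaf_eq_iff unfolding w(1) by blast
      then have "lf (q + B *v w) = lf (q + B *v v)" using B(2)[OF w(2) v] by blast
      then show "f x \<in> lf (q + B *v v) \<inter> horizontal_layer K q"
        unfolding w(1) f using leaf_eq_iff BN[OF w(2)] by (auto simp: horizontal_layer_def)
    qed
    show "lf (q + B *v v) \<inter> horizontal_layer K q \<subseteq> f ` (lf (p + v) \<inter> horizontal_layer K p)"
    proof
      fix x assume x: "x \<in> lf (q + B *v v) \<inter> horizontal_layer K q"
      then obtain w where w: "x = q + w" "w \<in> N" by (auto simp: horizontal_layer_def)
      let ?t = "transpose B *v w"
      have xt: "x = q + B *v ?t" unfolding cancel(2) by (rule w(1))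
      have "lf (q + B *v ?t) = lf (q + B *v v)" using x leaf_eq_iff unfolding xt[symmetric] by blast
      then have "lf (p + ?t) = lf (p + v)" using B(2)[OF tBN[OF w(2)] v] by blast
      then have "p + ?t \<in> lf (p + v) \<inter> horizontal_layer K p"
        using leaf_eq_iff tBN[OF w(2)] by (auto simp only: horizontal_layer_def)
      then show "x \<in> f ` (lf (p + v) \<inter> horizontal_layer K p)" using xt f by (metis image_eqI)
    qed
  qed
  have layer: "f ` horizontal_layer K p = horizontal_layer K q"
  proof
    show "f ` horizontal_layer K p \<subseteq> horizontal_layer K q" using BN f by (auto simp: horizontal_layer_def)
    show "horizontal_layer K q \<subseteq> f ` horizontal_layer K p"
    proof
      fix x assume "x \<in> horizontal_layer K q"
      then obtain w where w: "x = q + w" "w \<in> N" by (auto simp: horizontal_layer_def)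
      have "x = f (p + transpose B *v w)" unfolding f cancel(2) by (rule w(1))
      moreover have "p + transpose B *v w \<in> horizontal_layer K p"
        using tBN[OF w(2)] by (auto simp only: horizontal_layer_def)
      ultimately show "x \<in> f ` horizontal_layer K p" by (rule image_eqI)
    qed
  qed
  have iso: "dist (f x) (f y) = dist x y" for x y
    using cancel(4)[of "x - p" "y - p"] by (simp add: f_def dist_norm)
  have "(\<lambda>S. f ` S) ` induced_foliation \<F> (horizontal_layer K p) = induced_foliation \<F> (horizontal_layer K q)"
  proof
    show "(\<lambda>S. f ` S) ` induced_foliation \<F> (horizontal_layer K p) \<subseteq> induced_foliation \<F> (horizontal_layer K q)"
    proof
      fix S assume "S \<in> (\<lambda>S. f ` S) ` induced_foliation \<F> (horizontal_layer K p)"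
      then obtain L where L: "L \<in> \<F>" "S = f ` (L \<inter> horizontal_layer K p)"
        by (auto simp: induced_foliation_def)
      obtain v where v: "v \<in> N" "p + v \<in> L" using leaf_meets_layer[OF p L(1)] by blast
      have "S = lf (q + B *v v) \<inter> horizontal_layer K q"
        unfolding L(2) leaf_eqI[OF L(1) v(2), symmetric] by (rule slice[OF v(1)])
      then show "S \<in> induced_foliation \<F> (horizontal_layer K q)"
        unfolding induced_foliation_def using leaf_in by blast
    qed
    show "induced_foliation \<F> (horizontal_layer K q) \<subseteq> (\<lambda>S. f ` S) ` induced_foliation \<F> (horizontal_layer K p)"
    proof
      fix S assume "S \<in> induced_foliation \<F> (horizontal_layer K q)"
      then obtain L where L: "L \<in> \<F>" "S = L \<inter> horizontal_layer K q"
        by (auto simp: induced_foliation_def)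
      obtain v where v: "v \<in> N" "q + v \<in> L" using leaf_meets_layer[OF q L(1)] by blast
      have "lf (q + B *v (transpose B *v v)) = L" unfolding cancel(2) by (rule leaf_eqI[OF L(1) v(2)])
      then have "S = f ` (lf (p + transpose B *v v) \<inter> horizontal_layer K p)"
        unfolding slice[OF tBN[OF v(1)]] L(2) by simp
      then show "S \<in> (\<lambda>S. f ` S) ` induced_foliation \<F> (horizontal_layer K p)"
        unfolding induced_foliation_def using leaf_in by blast
    qed
  qed
  then show ?thesis unfolding isometric_foliations_def using layer iso by blast
qed

end

section \<open>Homogeneous foliations of the layers\<close>

lemma foliation_leaf_closed: assumes "foliation_leaf (S::'a::euclidean_space set)" shows "closed S"
proof -
  have "closed_map (top_of_set S) euclidean (\<lambda>x. x)"
    using assms unfolding foliation_leaf_def by (intro proper_imp_closed_map) blast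
  then have "closedin euclidean ((\<lambda>x. x) ` S)" unfolding closed_map_def by (metis closedin_topspace topspace_euclidean_subtopology)
  then show ?thesis by simp
qed

lemma SO_second_subset_fixing_group: "SO_second K \<subseteq> fixing_group K"
proof
  fix A assume A: "A \<in> SO_second K"
  have "A *v a = a" if a: "a \<in> first_factor K" for a
  proof -
    have "(A *v a) $ i = a $ i" for i
    proof -
      have "A $ i $ j * a $ j = (if j = i then a $ i else 0)" for j
        using A a by (cases "j \<in> K") (auto simp: SO_second_def first_factor_def)
      then show ?thesis by (simp add: matrix_vector_mult_def)
    qed
    then show ?thesis by (simp add: vec_eq_iff)
  qed
  then show "A \<in> fixing_group K" using A by (simp add: fixing_group_def SO_second_def rotation_matrix_def)
qed

text \<open>A leaf meets every layer because its slice is an orbit and thus nonempty. Two points of the same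
  slice differ by an element of the acting group, which preserves all slices and hence
  lies in the layer group.\<close>
lemma homogeneous_layers_of_foliation:
  assumes fol: "equidistant_foliation \<F>" and F0: "first_factor K \<in> \<F>"
    and hom: "\<forall>r \<in> first_factor K. homogeneous_on_layer K r (induced_foliation \<F> (horizontal_layer K r))"
  shows "homogeneous_layers \<F> K"
proof -
  have part: "partition_on UNIV \<F>" using fol by (simp add: equidistant_foliation_def)
  note uniq = leaf_unique[OF part] and leaf = leaf_mem[OF part]
  have orbit: "\<exists>H. connected_closed_subgroup_SO K H \<and> (\<forall>L\<in>\<F>. \<exists>u\<in>second_factor K.
      L \<inter> horizontal_layer K r = {r + A *v u |A. A \<in> H})" if r: "r \<in> first_factor K" for r
  proof -
    obtain H where H: "connected_closed_subgroup_SO K H"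
      "induced_foliation \<F> (horizontal_layer K r) = {{r + A *v (x - r) |A. A \<in> H} |x. x \<in> horizontal_layer K r}"
      using hom r unfolding homogeneous_on_layer_def by blast
    have "\<exists>u\<in>second_factor K. L \<inter> horizontal_layer K r = {r + A *v u |A. A \<in> H}" if L: "L \<in> \<F>" for L
    proof -
      have "L \<inter> horizontal_layer K r \<in> induced_foliation \<F> (horizontal_layer K r)"
        using L by (auto simp: induced_foliation_def)
      then obtain x where x: "x \<in> horizontal_layer K r" "L \<inter> horizontal_layer K r = {r + A *v (x - r) |A. A \<in> H}"
        unfolding H(2) by blast
      obtain u where "u \<in> second_factor K" "x = r + u" using x(1) by (auto simp: horizontal_layer_def)
      then show ?thesis using x(2) by (intro bexI[of _ u]) auto
    qed
    then show ?thesis using H(1) by blast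
  qed
  show ?thesis
  proof
    show "partition_on UNIV \<F>" by (rule part)
    show "closed L" if "L \<in> \<F>" for L
      using that fol by (auto simp: equidistant_foliation_def intro: foliation_leaf_closed)
    show "infdist x M = infdist y M" if "L \<in> \<F>" "M \<in> \<F>" "x \<in> L" "y \<in> L" for L M x y
      using that fol unfolding equidistant_foliation_def by blast
    show "first_factor K \<in> \<F>" by (rule F0)
    show "\<exists>v\<in>second_factor K. p + v \<in> L" if p: "p \<in> first_factor K" and L: "L \<in> \<F>" for p L
    proof -
      obtain H u where H: "connected_closed_subgroup_SO K H" "u \<in> second_factor K"
        "L \<inter> horizontal_layer K p = {p + A *v u |A. A \<in> H}"
        using orbit[OF p] L by blast
      have "p + mat 1 *v u \<in> L \<inter> horizontal_layer K p"
        unfolding H(3) using H(1) unfolding connected_closed_subgroup_SO_def by blast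
      then show ?thesis using H(2) by auto
    qed
    show "\<exists>Q\<in>layer_group \<F> K p. w = Q *v v"
      if p: "p \<in> first_factor K" and v: "v \<in> second_factor K" and w: "w \<in> second_factor K"
        and eq: "leaf \<F> (p + v) = leaf \<F> (p + w)" for p v w
    proof -
      obtain H where H: "connected_closed_subgroup_SO K H"
        "\<And>L. L \<in> \<F> \<Longrightarrow> \<exists>u\<in>second_factor K. L \<inter> horizontal_layer K p = {p + A *v u |A. A \<in> H}"
        using orbit[OF p] by blast
      have mulH: "A ** B \<in> H" if "A \<in> H" "B \<in> H" for A B
        using H(1) that unfolding connected_closed_subgroup_SO_def by blast
      have fixH: "A \<in> fixing_group K" if "A \<in> H" for A
        using H(1) that SO_second_subset_fixing_group unfolding connected_closed_subgroup_SO_def by blast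
      have sub: "H \<subseteq> layer_group \<F> K p"
      proof
        fix Q assume Q: "Q \<in> H"
        have "leaf \<F> (p + Q *v z) = leaf \<F> (p + z)" if z: "z \<in> second_factor K" for z
        proof -
          obtain u where u: "leaf \<F> (p + z) \<inter> horizontal_layer K p = {p + A *v u |A. A \<in> H}"
            using H(2)[OF leaf(1)] by blast
          have "p + z \<in> leaf \<F> (p + z) \<inter> horizontal_layer K p"
            using leaf(2) z by (auto simp: horizontal_layer_def)
          then obtain A where A: "A \<in> H" "z = A *v u" unfolding u by auto
          have "p + Q *v z = p + (Q ** A) *v u" unfolding A(2) by (simp add: matrix_vector_mul_assoc)
          then have "p + Q *v z \<in> leaf \<F> (p + z) \<inter> horizontal_layer K p"
            unfolding u using mulH[OF Q A(1)] by blast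
          then show ?thesis by (intro uniq leaf) blast
        qed
        then show "Q \<in> layer_group \<F> K p" using fixH[OF Q] by (simp add: layer_group_def)
      qed
      obtain u where u: "leaf \<F> (p + v) \<inter> horizontal_layer K p = {p + A *v u |A. A \<in> H}"
        using H(2)[OF leaf(1)] by blast
      have "p + v \<in> leaf \<F> (p + v) \<inter> horizontal_layer K p"
        using leaf(2) v by (auto simp: horizontal_layer_def)
      then obtain A where A: "A \<in> H" "v = A *v u" unfolding u by auto
      have "p + w \<in> leaf \<F> (p + v) \<inter> horizontal_layer K p"
        using leaf(2) w eq by (auto simp: horizontal_layer_def)
      then obtain B where B: "B \<in> H" "w = B *v u" unfolding u by auto
      have oA: "orthogonal_matrix A" using fixH[OF A(1)] by (simp add: fixing_group_def)
      have inv: "matrix_inv A ** A = mat 1"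
        using oA someI[of "\<lambda>M. A ** M = mat 1 \<and> M ** A = mat 1" "transpose A"]
        unfolding matrix_inv_def orthogonal_matrix_def by blast
      have invH: "matrix_inv A \<in> H"
        using H(1) A(1) unfolding connected_closed_subgroup_SO_def by blast
      have "(B ** matrix_inv A) *v v = (B ** (matrix_inv A ** A)) *v u"
        unfolding A(2) by (simp only: matrix_vector_mul_assoc matrix_mul_assoc)
      then have "w = (B ** matrix_inv A) *v v" unfolding inv B(2) by simp
      then show ?thesis using sub mulH[OF B(1) invH] by blast
    qed
  qed
qed

theorem proposition3p16:
  fixes \<F> :: "(real^'m) set set" and K :: "'m::finite set" and p q :: "real^'m"
  assumes "equidistant_foliation \<F>"
    and "first_factor K \<in> \<F>"
    and "\<forall>r \<in> first_factor K.
           homogeneous_on_layer K r (induced_foliation \<F> (horizontal_layer K r))"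
    and "p \<in> first_factor K" and "q \<in> first_factor K"
  shows "isometric_foliations
           (horizontal_layer K p) (induced_foliation \<F> (horizontal_layer K p))
           (horizontal_layer K q) (induced_foliation \<F> (horizontal_layer K q))"
  using homogeneous_layers.isometric_layers[OF homogeneous_layers_of_foliation[OF assms(1-3)] assms(4,5)] .

end
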